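(* Let $a,b,c,\alpha,\beta,\gamma$ be integers with $0\le\alpha<a$, $0\le\beta<b$, $0\le\gamma<c$ and at most one of $\alpha,\beta,\gamma$ zero. Suppose $a+b+c+\alpha+\beta+\gamma\equiv 0\pmod 3$, put $s=\frac13(a+b+c+\alpha+\beta+\gamma)-2$, $A=s+2-a$, $B=s+2-b$, $C=s+2-c$, $M=s+2-(\alpha+\beta+\gamma)$, and assume $0\le M$, $0\le A\le\beta+\gamma$, $0\le B\le\alpha+\gamma$, $0\le C\le\alpha+\beta$. If $c=\frac12(a+b+\gamma)-\alpha-\beta$, then $C=\alpha+\beta$ and $$\det N_{a,b,c,\alpha,\beta,\gamma}=\operatorname{Mac}(A,B,C+M).$$ Thus, for an infinite field $K$, the ideal $I_{a,b,c,\alpha,\beta,\gamma}=(x^a,y^b,z^c,x^\alpha y^\beta z^\gamma)$ of $K[x,y,z]$ has the weak Lefschetz property (that is, the algebra $K[x,y,z]/I_{a,b,c,\alpha,\beta,\gamma}$ has it) if the characteristic of $K$ is zero or at least $A+B+C+M=s+2=c+\alpha+\beta$.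
   Context: For non-negative integers $p,q,r$, $\operatorname{Mac}(p,q,r):=\dfrac{\mathcal H(p)\mathcal H(q)\mathcal H(r)\mathcal H(p+q+r)}{\mathcal H(p+q)\mathcal H(p+r)\mathcal H(q+r)}$, where $\mathcal H(n):=\prod_{i=0}^{n-1}i!$ is the hyperfactorial. $N_{a,b,c,\alpha,\beta,\gamma}$ is the $(C+M)\times(C+M)$ integer matrix with $(i,j)$ entry $\binom{c}{A+j-i}$ if $1\le i\le C$ and $\binom{\gamma}{A+C-\beta+j-i}$ if $C+1\le i\le C+M$, where $\binom nk=0$ if $k<0$ or $k>n$ (the determinant of the empty matrix is $1$). An artinian standard graded $K$-algebra $Q$ has the weak Lefschetz property if there is a linear form $\ell\in[Q]_1$ such that for all integers $d$ the map $\times\ell:[Q]_d\to[Q]_{d+1}$ is injective or surjective.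
   Formalization: The printed equality det N = Mac(A,B,C+M) fails in sign, e.g. for (a,b,c,α,β,γ) = (2,3,2,1,0,1), where det N = −1 and Mac(1,0,2) = 1; what is proved is det N = (−1)^{Mα} Mac(A,B,C+M). *)

theory Defs
  imports
    "Jordan_Normal_Form.Determinant"
    "HOL-Algebra.QuotRing"
    "HOL-Algebra.Algebraic_Closure_Type"
    "HOL-Library.Poly_Mapping"
begin

definition hyperfactorial :: "nat \<Rightarrow> nat" where
  "hyperfactorial n = (\<Prod>i<n. fact i)"

definition Mac :: "nat \<Rightarrow> nat \<Rightarrow> nat \<Rightarrow> rat" where
  "Mac p q r =
     of_nat (hyperfactorial p * hyperfactorial q * hyperfactorial r * hyperfactorial (p + q + r)) /
     of_nat (hyperfactorial (p + q) * hyperfactorial (p + r) * hyperfactorial (q + r))"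

definition int_binomial :: "int \<Rightarrow> int \<Rightarrow> int" where
  "int_binomial n k = (if k < 0 \<or> k > n then 0 else int (nat n choose nat k))"

text \<open>
  Rows and columns of \<^term>\<open>mat\<close> are numbered from 0. The entries depend on the column and row
  numbers only through their difference, so passing from numbering from 1 to numbering from 0 only
  turns the condition \<open>i \<le> C\<close> into \<open>i < C\<close>.

  The determinant is signed: for \<open>(a, b, c, \<alpha>, \<beta>, \<gamma>) = (2, 3, 2, 1, 0, 1)\<close> the matrix has
  rows \<open>2 1\<close> and \<open>1 0\<close>, so its determinant is \<open>-1\<close>, while \<open>Mac 1 0 2 = 1\<close>. An evaluation of the
  determinant by \<open>Mac\<close> therefore needs a sign, which is \<open>(-1) ^ (M * \<alpha>)\<close> if \<open>C = \<alpha> + \<beta>\<close> and \<open>c = \<gamma> + M\<close>.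
\<close>

definition N_matrix :: "int \<Rightarrow> int \<Rightarrow> int \<Rightarrow> int \<Rightarrow> int \<Rightarrow> int \<Rightarrow> int mat" where
  "N_matrix a b c \<alpha> \<beta> \<gamma> =
     (let s = (a + b + c + \<alpha> + \<beta> + \<gamma>) div 3 - 2;
          A = s + 2 - a; C = s + 2 - c; M = s + 2 - (\<alpha> + \<beta> + \<gamma>)
      in mat (nat (C + M)) (nat (C + M))
           (\<lambda>(i, j). if int i < C then int_binomial c (A + int j - int i)
                     else int_binomial \<gamma> (A + C - \<beta> + int j - int i)))"

datatype xyz = Var_x | Var_y | Var_z

type_synonym 'k poly3 = "(xyz \<Rightarrow>\<^sub>0 nat) \<Rightarrow>\<^sub>0 'k"

abbreviation poly3_ring :: "'k::field poly3 ring" where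
  "poly3_ring \<equiv> ring_of_type_algebra"

definition monomial3 :: "nat \<Rightarrow> nat \<Rightarrow> nat \<Rightarrow> 'k::field poly3" where
  "monomial3 i j k =
     Poly_Mapping.single
       (Poly_Mapping.single Var_x i + Poly_Mapping.single Var_y j + Poly_Mapping.single Var_z k) 1"

definition homogeneous :: "int \<Rightarrow> 'k::field poly3 set" where
  "homogeneous d =
     {f. \<forall>m \<in> Poly_Mapping.keys f.
           int (Poly_Mapping.lookup m Var_x + Poly_Mapping.lookup m Var_y + Poly_Mapping.lookup m Var_z) = d}"

definition I_ideal :: "int \<Rightarrow> int \<Rightarrow> int \<Rightarrow> int \<Rightarrow> int \<Rightarrow> int \<Rightarrow> 'k::field poly3 set" where
  "I_ideal a b c \<alpha> \<beta> \<gamma> =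
     Idl\<^bsub>poly3_ring\<^esub>
       {monomial3 (nat a) 0 0, monomial3 0 (nat b) 0, monomial3 0 0 (nat c),
        monomial3 (nat \<alpha>) (nat \<beta>) (nat \<gamma>)}"

text \<open>
  \<open>G d\<close> is the homogeneous component of degree \<open>d\<close> of the graded algebra \<open>Q\<close>; components of negative
  degree are included and are zero. The scalar action plays no role in the property.
\<close>

definition weak_Lefschetz :: "('q, 'm) ring_scheme \<Rightarrow> (int \<Rightarrow> 'q set) \<Rightarrow> bool" where
  "weak_Lefschetz Q G \<longleftrightarrow>
     (\<exists>l \<in> G 1. \<forall>d. inj_on (\<lambda>x. l \<otimes>\<^bsub>Q\<^esub> x) (G d) \<or> (\<lambda>x. l \<otimes>\<^bsub>Q\<^esub> x) ` G d = G (d + 1))"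

definition quotient_component :: "'k::field poly3 set \<Rightarrow> int \<Rightarrow> 'k poly3 set set" where
  "quotient_component I d = (\<lambda>f. I +>\<^bsub>poly3_ring\<^esub> f) ` homogeneous d"

definition ideal_weak_Lefschetz :: "'k::field poly3 set \<Rightarrow> bool" where
  "ideal_weak_Lefschetz I \<longleftrightarrow> weak_Lefschetz (poly3_ring Quot I) (quotient_component I)"

end

theory Submission
  imports Defs
begin

text \<open>
  The hypothesis on \<open>c\<close> forces \<open>C = \<alpha> + \<beta>\<close>, \<open>\<gamma> = A + B\<close> and \<open>c = \<gamma> + M\<close>. Read a row of \<open>N\<close> as a
  window of coefficients, at the positions \<open>A, ..., A + n - 1\<close> with \<open>n = C + M\<close>, of a polynomial in
  \<open>T\<close>: the first \<open>C\<close> rows come from \<open>T^i (1 + T)^c\<close>, the others from \<open>T^(\<beta> + k) (1 + T)^\<gamma>\<close>. As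
  \<open>c = \<gamma> + M\<close>, all of them are multiples of \<open>(1 + T)^\<gamma>\<close>, with cofactors \<open>T^i (1 + T)^M\<close> and
  \<open>T^(\<beta> + k)\<close> of degree less than \<open>n\<close>. Hence \<open>N = R P\<close>, where \<open>R\<close> has the coefficients of the
  cofactors as its rows and \<open>P\<close> has the entries \<open>(A + B) choose (A + j - i)\<close>. Moving the last \<open>M\<close>
  rows of \<open>R\<close> above the \<open>\<alpha>\<close> rows preceding them makes \<open>R\<close> block triangular with unitriangular
  blocks, so \<open>det R\<close> is the sign \<open>(-1)^(M \<alpha>)\<close> of that move (\<open>det_N_matrix_nat\<close>).

  For \<open>P\<close>, column operations that add the columns according to Vandermonde's convolution turn the
  entries into \<open>(A + B + j) choose (A + j - i)\<close>. After factorials are pulled out of rows and columns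
  the entries are \<open>(A + j) choose i\<close>, a product of two unitriangular matrices. So \<open>det P\<close> is a
  quotient of products of factorials, which is \<open>Mac A B n\<close> (\<open>det_binomial_toeplitz_Mac\<close>). Only
  factorials of numbers below \<open>A + B + n = s + 2\<close> occur, whence \<open>det N\<close> does not vanish in a field
  of characteristic zero or at least \<open>s + 2\<close> (\<open>det_binomial_toeplitz_neq_0\<close>).

  For the Lefschetz property take the form \<open>l = z - x - y\<close>. Setting \<open>x = 1\<close>, \<open>y = T\<close>, \<open>z = 1 + T\<close>
  identifies forms of degree \<open>e\<close> modulo \<open>l\<close> with polynomials of degree at most \<open>e\<close> in \<open>T\<close>
  (\<open>homogeneous_reducible_to_line\<close>), and turns the four generators of the ideal into \<open>1\<close>, \<open>T^b\<close>,
  \<open>(1 + T)^c\<close> and \<open>T^\<beta> (1 + T)^\<gamma>\<close>. Let \<open>\<Phi>_d\<close> be the map that sends four polynomials, of degrees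
  bounded so that the products with the generators have degree at most \<open>d + 1\<close> as forms, to the
  resulting combination. If \<open>\<Phi>_d\<close> is onto, then every form of degree \<open>d + 1\<close> lies in the ideal
  modulo \<open>l\<close>, so multiplication by \<open>l\<close> from degree \<open>d\<close> to degree \<open>d + 1\<close> is onto. If \<open>\<Phi>_d\<close> is
  one-to-one, then multiplication by \<open>l\<close> is: from \<open>l f = \<Sum> m_i u_i\<close>, with \<open>m_i\<close> the generators, it
  follows that each \<open>u_i\<close> vanishes modulo \<open>l\<close>, say \<open>u_i = l v_i\<close>, and cancelling \<open>l\<close> gives
  \<open>f = \<Sum> m_i v_i\<close>. For \<open>d = s\<close> the map \<open>\<Phi>_d\<close> goes between spaces of the same dimension
  \<open>A + B + C + M = s + 2\<close>; the polynomials \<open>1, ..., T^(A - 1)\<close> and \<open>T^b, ..., T^(s + 1)\<close> cover all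
  positions outside the window, so that \<open>\<Phi>_s\<close> is bijective because \<open>det N\<close> is a unit
  (\<open>combination_eq_0\<close>, \<open>combination_exists_critical\<close>). Injectivity passes to smaller \<open>d\<close> by
  restriction and surjectivity to larger \<open>d\<close> by multiplication with \<open>T\<close>.
\<close>

hide_const (open) UnivPoly.monom UnivPoly.coeff

section \<open>The determinant of a Toeplitz matrix of binomial coefficients\<close>

text \<open>
  The image of the monomial \<open>x^k y^i z^g\<close> under \<open>x = 1\<close>, \<open>y = T\<close>, \<open>z = 1 + T\<close>. Its coefficients
  are a shifted row of Pascal's triangle.
\<close>

definition binomial_row :: "nat \<Rightarrow> nat \<Rightarrow> 'a::comm_ring_1 poly" where
  "binomial_row i g = monom 1 i * [:1, 1:] ^ g"

lemma coeff_binomial_row: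
  "coeff (binomial_row i g :: 'a::comm_ring_1 poly) k = of_int (int_binomial (int g) (int k - int i))"
proof (cases "i \<le> k")
  case True
  have "coeff ([:1, 1:] ^ g :: 'a poly) m = of_nat (g choose m)" for m
  proof (induction g arbitrary: m)
    case (Suc g)
    then show ?case by (cases m) (simp_all add: add.commute)
  qed (simp add: binomial_eq_0 coeff_1)
  moreover have "nat (int k - int i) = k - i" using True by simp
  ultimately show ?thesis using True
    by (auto simp: binomial_row_def coeff_monom_mult int_binomial_def binomial_eq_0)
next
  case False
  then show ?thesis by (simp add: binomial_row_def coeff_monom_mult int_binomial_def)
qed

lemma det_scale_rows_cols:
  fixes Y :: "nat \<Rightarrow> nat \<Rightarrow> 'a::comm_ring_1"
  shows "det (mat n n (\<lambda>(i, j). f i * g j * Y i j))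
    = (\<Prod>i<n. f i) * (\<Prod>j<n. g j) * det (mat n n (\<lambda>(i, j). Y i j))"
proof -
  have eq: "(\<Prod>i = 0..<n. mat n n (\<lambda>(i, j). f i * g j * Y i j) $$ (i, p i))
      = (\<Prod>i<n. f i) * (\<Prod>j<n. g j) * (\<Prod>i = 0..<n. mat n n (\<lambda>(i, j). Y i j) $$ (i, p i))"
    if p: "p permutes {0..<n}" for p
  proof -
    have "p i < n" if "i < n" for i using permutes_in_image[OF p, of i] that by simp
    then have "(\<Prod>i = 0..<n. mat n n (\<lambda>(i, j). f i * g j * Y i j) $$ (i, p i))
      = (\<Prod>i = 0..<n. f i * g (p i) * Y i (p i))" by (intro prod.cong) auto
    also have "\<dots> = (\<Prod>i = 0..<n. f i) * (\<Prod>i = 0..<n. g (p i)) * (\<Prod>i = 0..<n. Y i (p i))"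
      by (simp add: prod.distrib)
    also have "(\<Prod>i = 0..<n. g (p i)) = (\<Prod>j = 0..<n. g j)"
      using prod.permute[OF p, of g] by (simp add: o_def)
    also have "(\<Prod>i = 0..<n. Y i (p i)) = (\<Prod>i = 0..<n. mat n n (\<lambda>(i, j). Y i j) $$ (i, p i))"
      using \<open>\<And>i. i < n \<Longrightarrow> p i < n\<close> by (intro prod.cong) auto
    finally show ?thesis by (simp add: lessThan_atLeast0)
  qed
  show ?thesis
    unfolding det_def'[OF mat_carrier] sum_distrib_left
    by (intro sum.cong refl, simp only: mem_Collect_eq eq, simp only: mult_ac)
qed

text \<open>
  Upper and lower triangular matrices are covered at once, so that all triangular factors below
  are treated by the same rule.
\<close>

lemma det_unitriangular:
  fixes D :: "'a::comm_ring_1 mat"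
  assumes "D \<in> carrier_mat n n" "\<And>i. i < n \<Longrightarrow> D $$ (i, i) = 1"
    and "(\<forall>i j. j < i \<longrightarrow> i < n \<longrightarrow> D $$ (i, j) = 0) \<or> (\<forall>i j. i < j \<longrightarrow> j < n \<longrightarrow> D $$ (i, j) = 0)"
  shows "det D = 1"
proof -
  have "diag_mat D = replicate n 1"
    using assms(1,2) by (intro nth_equalityI) (auto simp: diag_mat_def)
  then have diag: "prod_list (diag_mat D) = 1" by simp
  from assms(3) show ?thesis
  proof
    assume "\<forall>i j. j < i \<longrightarrow> i < n \<longrightarrow> D $$ (i, j) = 0"
    then have "upper_triangular D" using assms(1) by (auto simp: upper_triangular_def)
    from det_upper_triangular[OF this assms(1)] diag show ?thesis by simp
  next
    assume "\<forall>i j. i < j \<longrightarrow> j < n \<longrightarrow> D $$ (i, j) = 0"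
    with det_lower_triangular[OF _ assms(1)] diag show ?thesis by auto
  qed
qed

text \<open>
  Compare coefficients in \<open>T^i (1 + T)^(g + j) = (1 + T)^j (T^i (1 + T)^g)\<close>. For \<open>j < n\<close> the
  summation index may run over all columns, which makes this an identity of \<open>n \<times> n\<close> matrices.
\<close>

lemma int_binomial_Vandermonde:
  "(\<Sum>l<n. int_binomial (int g) (int A + int l - int i) * int (j choose l))
     = int_binomial (int (g + j)) (int A + int j - int i)" if "j < n"
proof -
  let ?row = "\<lambda>i g. binomial_row i g :: int poly"
  have row: "int_binomial (int m) (int A + int l - int i) = coeff (?row i m) (A + l)" for m l
    by (simp add: coeff_binomial_row)
  have coeff_j: "coeff ([:1, 1:] ^ j :: int poly) k = int (j choose k)" for k
    using coeff_binomial_row[of 0 j k, where ?'a = int]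
    by (auto simp: binomial_row_def monom_0 int_binomial_def binomial_eq_0 split: if_splits)
  have "?row i (g + j) = [:1, 1:] ^ j * ?row i g"
    by (simp add: binomial_row_def power_add mult_ac)
  then have "coeff (?row i (g + j)) (A + j)
      = (\<Sum>k\<le>A + j. int (j choose k) * coeff (?row i g) (A + j - k))"
    by (simp add: coeff_mult coeff_j)
  also have "\<dots> = (\<Sum>k\<le>j. int (j choose k) * coeff (?row i g) (A + j - k))"
    by (rule sum.mono_neutral_right) (auto simp: binomial_eq_0)
  also have "\<dots> = (\<Sum>l\<le>j. int (j choose l) * coeff (?row i g) (A + l))"
    by (rule sum.reindex_bij_witness[of _ "\<lambda>l. j - l" "\<lambda>l. j - l"])
      (auto simp: binomial_symmetric[symmetric])
  also have "\<dots> = (\<Sum>l<n. int (j choose l) * coeff (?row i g) (A + l))"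
    using that by (intro sum.mono_neutral_left) (auto simp: binomial_eq_0)
  finally show ?thesis unfolding row by (simp only: mult.commute)
qed

text \<open>
  Vandermonde's convolution is an LU decomposition of this matrix with unitriangular factors.
\<close>

lemma det_binomial_triangle: "det (mat n n (\<lambda>(i, j). int (A + j choose i))) = 1"
proof -
  let ?L = "mat n n (\<lambda>(i, k). if k \<le> i then int (A choose (i - k)) else 0)"
  let ?U = "mat n n (\<lambda>(k, j). int (j choose k))"
  have "mat n n (\<lambda>(i, j). int (A + j choose i)) = ?L * ?U"
  proof (rule eq_matI)
    fix i j assume "i < dim_row (?L * ?U)" "j < dim_col (?L * ?U)"
    then have ij: "i < n" "j < n" by auto
    have "int (A + j choose i) = (\<Sum>k\<le>i. int (A choose (i - k)) * int (j choose k))"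
      using vandermonde[of j A i]
      by (simp add: add.commute mult.commute flip: of_nat_mult of_nat_sum)
    also have "\<dots> = (\<Sum>k<n. (if k \<le> i then int (A choose (i - k)) else 0) * int (j choose k))"
      using ij by (intro sum.mono_neutral_cong_left) auto
    finally show "mat n n (\<lambda>(i, j). int (A + j choose i)) $$ (i, j) = (?L * ?U) $$ (i, j)"
      using ij by (simp add: scalar_prod_def lessThan_atLeast0)
  qed auto
  moreover have "det ?L = 1" by (rule det_unitriangular[of _ n]) auto
  moreover have "det ?U = 1" by (rule det_unitriangular[of _ n]) (auto simp: binomial_eq_0)
  ultimately show ?thesis by (simp add: det_mult[of _ n])
qed

definition binomial_toeplitz :: "nat \<Rightarrow> nat \<Rightarrow> nat \<Rightarrow> int mat" where
  "binomial_toeplitz n A g = mat n n (\<lambda>(i, j). int_binomial (int g) (int A + int j - int i))"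

text \<open>
  Multiplication from the right by the unitriangular matrix of the numbers \<open>j choose l\<close> raises the
  upper argument in column \<open>j\<close> from \<open>A + B\<close> to \<open>A + B + j\<close>. The new entry is
  \<open>(A + B + j)! / ((A + j - i)! (B + i)!)\<close>, in which the denominator factor \<open>(B + i)!\<close> depends on the
  row only; up to row and column factors it is \<open>(A + j) choose i\<close>. The identity is stated without
  division so that it can be read modulo a prime.
\<close>

lemma det_binomial_toeplitz_fact:
  "(\<Prod>i<n. fact (B + i)) * (\<Prod>j<n. fact (A + j)) * det (binomial_toeplitz n A (A + B))
    = ((\<Prod>i<n. fact i) * (\<Prod>j<n. fact (A + B + j)) :: int)"
proof -
  let ?U = "mat n n (\<lambda>(k, j). int (j choose k))"
  let ?Z = "\<lambda>i j. int_binomial (int (A + B + j)) (int A + int j - int i)"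
  have "binomial_toeplitz n A (A + B) * ?U = mat n n (\<lambda>(i, j). ?Z i j)"
  proof (rule eq_matI)
    fix i j assume "i < dim_row (mat n n (\<lambda>(i, j). ?Z i j))" "j < dim_col (mat n n (\<lambda>(i, j). ?Z i j))"
    then show "(binomial_toeplitz n A (A + B) * ?U) $$ (i, j) = mat n n (\<lambda>(i, j). ?Z i j) $$ (i, j)"
      using int_binomial_Vandermonde[of j n "A + B" A i]
      by (simp add: binomial_toeplitz_def scalar_prod_def lessThan_atLeast0)
  qed (auto simp: binomial_toeplitz_def)
  moreover have "det ?U = 1" by (rule det_unitriangular[of _ n]) (auto simp: binomial_eq_0)
  moreover have "binomial_toeplitz n A (A + B) \<in> carrier_mat n n" by (simp add: binomial_toeplitz_def)
  ultimately have "det (binomial_toeplitz n A (A + B)) = det (mat n n (\<lambda>(i, j). ?Z i j))"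
    using det_mult[of "binomial_toeplitz n A (A + B)" n ?U] by simp
  moreover have "fact (B + i) * fact (A + j) * ?Z i j
      = fact i * fact (A + B + j) * int (A + j choose i)" for i j
  proof (cases "i \<le> A + j")
    case True
    have "nat (int A + int j - int i) = A + j - i" "A + B + j - (A + j - i) = B + i"
      using True by auto
    then have "?Z i j = int (A + B + j choose (A + j - i))"
      using True by (auto simp: int_binomial_def nat_add_distrib)
    moreover have "int (fact (A + j - i) * fact (B + i) * (A + B + j choose (A + j - i))) = int (fact (A + B + j))"
      using binomial_fact_lemma[of "A + j - i" "A + B + j"] \<open>A + B + j - (A + j - i) = B + i\<close>
      by (intro arg_cong[of _ _ int]) simp
    moreover have "int (fact i * fact (A + j - i) * (A + j choose i)) = int (fact (A + j))"
      using binomial_fact_lemma[of i "A + j"] True by (intro arg_cong[of _ _ int]) simp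
    ultimately have "fact (B + i) * fact (A + j) * ?Z i j * fact (A + j - i)
      = fact i * fact (A + B + j) * int (A + j choose i) * fact (A + j - i)"
      by (simp add: algebra_simps del: of_nat_add)
    then show ?thesis by (simp del: of_nat_add)
  next
    case False
    then show ?thesis by (simp add: int_binomial_def binomial_eq_0)
  qed
  ultimately show ?thesis
    using det_scale_rows_cols[of n "\<lambda>i. fact (B + i)" "\<lambda>j. fact (A + j)" ?Z]
      det_scale_rows_cols[of n "\<lambda>i. fact i" "\<lambda>j. fact (A + B + j)" "\<lambda>i j. int (A + j choose i)"]
    by (simp add: det_binomial_triangle)
qed

lemma hyperfactorial_add: "hyperfactorial (k + n) = hyperfactorial k * (\<Prod>i<n. fact (k + i))"
  by (induction n) (simp_all add: hyperfactorial_def)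

lemma hyperfactorial_pos: "hyperfactorial n > 0"
  by (simp add: hyperfactorial_def prod_pos)

lemma det_binomial_toeplitz_Mac: "rat_of_int (det (binomial_toeplitz n A (A + B))) = Mac A B n"
proof -
  have "of_int ((\<Prod>i<n. fact (B + i)) * (\<Prod>j<n. fact (A + j)) * det (binomial_toeplitz n A (A + B)))
    = (of_int ((\<Prod>i<n. fact i) * (\<Prod>j<n. fact (A + B + j))) :: rat)"
    by (simp only: det_binomial_toeplitz_fact)
  then have *: "(\<Prod>i<n. fact (B + i)) * (\<Prod>j<n. fact (A + j)) * rat_of_int (det (binomial_toeplitz n A (A + B)))
    = (\<Prod>i<n. fact i) * (\<Prod>j<n. fact (A + B + j))" by (simp add: of_int_prod)
  have H: "rat_of_nat (hyperfactorial (k + n)) = of_nat (hyperfactorial k) * (\<Prod>i<n. fact (k + i))" for k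
    by (simp add: hyperfactorial_add)
  have Hn: "rat_of_nat (hyperfactorial n) = (\<Prod>i<n. fact i)" by (simp add: hyperfactorial_def)
  have nz: "rat_of_nat (hyperfactorial k) \<noteq> 0" for k using hyperfactorial_pos[of k] by simp
  have nz': "(\<Prod>i<n. fact (k + i) :: rat) \<noteq> 0" for k by simp
  show ?thesis
    unfolding Mac_def of_nat_mult H[of "A + B"] H[of A] H[of B] unfolding Hn
    using * nz[of A] nz[of B] nz[of "A + B"] nz'[of A] nz'[of B] by (simp add: field_simps)
qed

section \<open>The determinant of the matrix N\<close>

lemma det_block_unitriangular:
  fixes D :: "'a::idom mat"
  assumes D: "D \<in> carrier_mat n n" and "p \<le> n" and diag: "\<And>i. i < n \<Longrightarrow> D $$ (i, i) = 1"
    and upper: "\<And>i j. i < p \<Longrightarrow> j < n \<Longrightarrow> j < i \<or> p \<le> j \<Longrightarrow> D $$ (i, j) = 0"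
    and lower: "\<And>i j. p \<le> i \<Longrightarrow> i < j \<Longrightarrow> j < n \<Longrightarrow> D $$ (i, j) = 0"
  shows "det D = 1"
proof -
  let ?A = "mat p p (\<lambda>(i, j). D $$ (i, j))"
  let ?C = "mat (n - p) p (\<lambda>(i, j). D $$ (p + i, j))"
  let ?E = "mat (n - p) (n - p) (\<lambda>(i, j). D $$ (p + i, p + j))"
  have "D = four_block_mat ?A (0\<^sub>m p (n - p)) ?C ?E"
    using D \<open>p \<le> n\<close> upper by (intro eq_matI) auto
  also have "det \<dots> = det ?A * det ?E"
    by (rule det_four_block_mat_upper_right_zero) auto
  also have "det ?A = 1"
    using \<open>p \<le> n\<close> diag upper by (intro det_unitriangular[of _ p]) auto
  also have "det ?E = 1"
    using \<open>p \<le> n\<close> diag lower by (intro det_unitriangular[of _ "n - p"]) auto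
  finally show ?thesis by simp
qed

text \<open>
  Multiplication of polynomials of degree less than \<open>n\<close> by a fixed polynomial is given by a matrix.
\<close>

lemma coeff_mult_binomial_row:
  fixes r :: "'a::comm_ring_1 poly"
  assumes "\<And>k. n \<le> k \<Longrightarrow> coeff r k = 0"
  shows "coeff (r * binomial_row i g) m = (\<Sum>k<n. coeff r k * coeff (binomial_row (i + k) g) m)"
proof -
  have "r = (\<Sum>k<n. monom (coeff r k) k)"
    by (rule poly_eqI) (auto simp: coeff_sum coeff_monom assms)
  then have "r * binomial_row i g = (\<Sum>k<n. monom (coeff r k) k) * binomial_row i g" by simp
  also have "\<dots> = (\<Sum>k<n. smult (coeff r k) (binomial_row (i + k) g))"
    by (simp add: sum_distrib_right binomial_row_def smult_monom mult_monom add.commute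
        flip: mult.assoc mult_smult_left)
  finally show ?thesis by (simp add: coeff_sum)
qed

text \<open>
  The matrix \<open>N\<close> in the situation of the theorem, where \<open>C = \<alpha> + \<beta>\<close>, \<open>\<gamma> = A + B\<close> and
  \<open>c = A + B + M\<close>, with its entries read as coefficients. A lower row \<open>i = \<alpha> + \<beta> + k\<close> belongs to
  \<open>T^(\<beta> + k)\<close>, whose exponent is \<open>i - \<alpha>\<close>.
\<close>

definition N_matrix_nat :: "nat \<Rightarrow> nat \<Rightarrow> nat \<Rightarrow> nat \<Rightarrow> nat \<Rightarrow> int mat" where
  "N_matrix_nat A B M \<alpha> \<beta> = mat (\<alpha> + \<beta> + M) (\<alpha> + \<beta> + M)
     (\<lambda>(i, j). if i < \<alpha> + \<beta> then coeff (binomial_row i (A + B + M)) (A + j)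
       else coeff (binomial_row (i - \<alpha>) (A + B)) (A + j))"

lemma binomial_row_mult: "binomial_row i g * binomial_row j h = binomial_row (i + j) (h + g)"
proof -
  have "monom 1 (i + j) = (monom 1 i * monom 1 j :: 'a poly)" by (simp add: mult_monom)
  then show ?thesis by (simp add: binomial_row_def power_add mult_ac)
qed

text \<open>
  Let \<open>r i\<close> be the cofactors of \<open>(1 + T)^(A + B)\<close> in the rows, after the last \<open>M\<close> rows have been
  moved above the \<open>\<alpha>\<close> rows preceding them. In their new order the cofactors are
  \<open>T^i (1 + T)^M\<close> for \<open>i < \<beta>\<close>, with lowest term \<open>T^i\<close>; then the powers \<open>T^i\<close>; and finally
  \<open>T^(i - M) (1 + T)^M\<close>, with leading term \<open>T^i\<close>. The first two kinds have degree less than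
  \<open>\<beta> + M\<close>, so the coefficient matrix has the shape of \<open>det_block_unitriangular\<close>.
\<close>

lemma det_N_matrix_nat: "det (N_matrix_nat A B M \<alpha> \<beta>) = (-1) ^ (M * \<alpha>) * det (binomial_toeplitz (\<alpha> + \<beta> + M) A (A + B))"
proof -
  let ?n = "\<alpha> + \<beta> + M"
  define r :: "nat \<Rightarrow> int poly" where
    "r i = (if i < \<beta> then binomial_row i M else if i < \<beta> + M then binomial_row i 0
       else binomial_row (i - M) M)" for i
  let ?R = "mat ?n ?n (\<lambda>(i, j). coeff (r i) j)"
  let ?S = "mat ?n ?n (\<lambda>(i, j). N_matrix_nat A B M \<alpha> \<beta> $$
    (if i < \<beta> then i else if i < \<beta> + M then i + \<alpha> else i - M, j))"
  have coeff_r: "coeff (r i) k = (if i < \<beta> then int_binomial (int M) (int k - int i)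
      else if i < \<beta> + M then of_bool (k = i)
      else int_binomial (int M) (int k - int (i - M)))" for i k
    by (auto simp: r_def coeff_binomial_row int_binomial_def of_bool_def)
  have "?S = ?R * binomial_toeplitz ?n A (A + B)"
  proof (rule eq_matI)
    fix i j assume "i < dim_row (?R * binomial_toeplitz ?n A (A + B))" "j < dim_col (?R * binomial_toeplitz ?n A (A + B))"
    then have ij: "i < ?n" "j < ?n" by (auto simp: binomial_toeplitz_def)
    have "?S $$ (i, j) = coeff (r i * binomial_row 0 (A + B)) (A + j)"
      using ij by (auto simp: N_matrix_nat_def r_def binomial_row_mult)
    also have "\<dots> = (\<Sum>k<?n. coeff (r i) k * coeff (binomial_row (0 + k) (A + B)) (A + j))"
      by (rule coeff_mult_binomial_row) (use ij in \<open>auto simp: coeff_r int_binomial_def\<close>)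
    also have "\<dots> = (?R * binomial_toeplitz ?n A (A + B)) $$ (i, j)"
      using ij by (simp add: scalar_prod_def lessThan_atLeast0 binomial_toeplitz_def coeff_binomial_row)
    finally show "?S $$ (i, j) = (?R * binomial_toeplitz ?n A (A + B)) $$ (i, j)" .
  qed (auto simp: binomial_toeplitz_def)
  moreover have "det ?R = 1"
    by (rule det_block_unitriangular[of _ ?n "\<beta> + M"]) (auto simp: coeff_r int_binomial_def)
  moreover have "det (N_matrix_nat A B M \<alpha> \<beta>) = (- 1) ^ (\<alpha> * M) * det ?S"
    by (rule det_swap_final_rows) (auto simp: N_matrix_nat_def)
  moreover have "binomial_toeplitz ?n A (A + B) \<in> carrier_mat ?n ?n" by (simp add: binomial_toeplitz_def)
  ultimately show ?thesis
    by (simp add: det_mult[of _ ?n] mult.commute)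
qed

lemma N_matrix_eq_N_matrix_nat:
  assumes "A + B + M + \<alpha> + \<beta> = s'" "a = int (s' - A)" "b = int (s' - B)" "c = int (A + B + M)"
    "\<gamma> = int (A + B)"
  shows "N_matrix a b c (int \<alpha>) (int \<beta>) \<gamma> = N_matrix_nat A B M \<alpha> \<beta>"
proof -
  have "a + b + c + int \<alpha> + int \<beta> + \<gamma> = 3 * int s'" using assms by auto
  then have s: "(a + b + c + int \<alpha> + int \<beta> + \<gamma>) div 3 - 2 + 2 = int s'" by simp
  show ?thesis
    unfolding N_matrix_def N_matrix_nat_def Let_def s
    using assms by (intro eq_matI) (auto simp: coeff_binomial_row algebra_simps of_nat_diff)
qed

text \<open>
  A prime does not divide the factorial of a smaller number.
\<close>

lemma fact_neq_0_in_field: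
  assumes "CHAR('k::field) = 0 \<or> m < CHAR('k)"
  shows "(of_int (fact m) :: 'k) \<noteq> 0"
proof -
  have "of_int (fact m) = (of_nat (fact m) :: 'k)" by (metis of_int_of_nat_eq of_nat_fact)
  also have "\<dots> \<noteq> 0"
  proof (cases "CHAR('k) = 0")
    case False
    then have "CHAR('k) > 0" by simp
    from prime_dvd_fact_iff[OF prime_CHAR_semidom[OF this]] assms False
    show ?thesis by (auto simp: of_nat_eq_0_iff_char_dvd)
  qed (simp add: of_nat_eq_0_iff_char_dvd)
  finally show ?thesis .
qed

lemma det_binomial_toeplitz_neq_0:
  assumes "CHAR('k::field) = 0 \<or> A + B + n \<le> CHAR('k)"
  shows "(of_int (det (binomial_toeplitz n A (A + B))) :: 'k) \<noteq> 0"
proof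
  assume *: "(of_int (det (binomial_toeplitz n A (A + B))) :: 'k) = 0"
  have nz: "(\<Prod>i<n. of_int (fact (m + i)) :: 'k) \<noteq> 0" if "m \<le> A + B" for m
  proof -
    have "(of_int (fact (m + i)) :: 'k) \<noteq> 0" if "i < n" for i
    proof (rule fact_neq_0_in_field)
      show "CHAR('k) = 0 \<or> m + i < CHAR('k)" using assms \<open>m \<le> A + B\<close> that by arith
    qed
    then show ?thesis by (simp only: prod_zero_iff finite_lessThan lessThan_iff Bex_def) metis
  qed
  have "(of_int ((\<Prod>i<n. fact i) * (\<Prod>j<n. fact (A + B + j))) :: 'k)
    = of_int ((\<Prod>i<n. fact (B + i)) * (\<Prod>j<n. fact (A + j)) * det (binomial_toeplitz n A (A + B)))"
    by (simp only: det_binomial_toeplitz_fact)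
  with * have "(\<Prod>i<n. of_int (fact (0 + i))) * (\<Prod>j<n. of_int (fact (A + B + j))) = (0::'k)"
    by (simp add: of_int_prod)
  with nz[of 0] nz[of "A + B"] show False by (simp only: mult_eq_0_iff) simp
qed

section \<open>Univariate polynomials and the matrix N\<close>

text \<open>
  A strict degree bound which for \<open>n = 0\<close> leaves only the zero polynomial. With \<open>degree p < n\<close>
  instead, forms of negative degree would need a separate treatment.
\<close>

definition coeffs_below :: "nat \<Rightarrow> 'a::zero poly \<Rightarrow> bool" where
  "coeffs_below n p \<longleftrightarrow> (\<forall>k\<ge>n. coeff p k = 0)"

lemma coeffs_below_mono: "coeffs_below m p \<Longrightarrow> m \<le> n \<Longrightarrow> coeffs_below n p"
  by (auto simp: coeffs_below_def)

lemma coeffs_below_0 [simp]: "coeffs_below n 0"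
  by (simp add: coeffs_below_def)

lemma poly_with_coeffs: "\<exists>p. coeffs_below n p \<and> (\<forall>k<n. coeff p k = (f k :: 'a::comm_ring_1))"
  by (rule exI[of _ "\<Sum>k<n. monom (f k) k"]) (auto simp: coeffs_below_def coeff_sum coeff_monom)

text \<open>
  The map \<open>\<Phi>\<close>: the combination of the images \<open>1\<close>, \<open>T^b\<close>, \<open>(1 + T)^c\<close>, \<open>T^\<beta> (1 + T)^\<gamma>\<close> of
  the generators \<open>x^a\<close>, \<open>y^b\<close>, \<open>z^c\<close>, \<open>x^\<alpha> y^\<beta> z^\<gamma>\<close> with given polynomials.
\<close>

definition combination ::
  "nat \<Rightarrow> nat \<Rightarrow> nat \<Rightarrow> nat \<Rightarrow> 'a poly \<Rightarrow> 'a poly \<Rightarrow> 'a poly \<Rightarrow> 'a poly \<Rightarrow> 'a::comm_ring_1 poly" where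
  "combination b c \<beta> \<gamma> u1 u2 u3 u4 = u1 * binomial_row 0 0 + u2 * binomial_row b 0
     + u3 * binomial_row 0 c + u4 * binomial_row \<beta> \<gamma>"

lemma binomial_row_0_0 [simp]: "binomial_row 0 0 = 1"
  by (simp add: binomial_row_def)

lemma coeff_mult_binomial_row_0:
  "coeff (u * binomial_row b 0) k = (if k < b then 0 else coeff u (k - b))"
  by (simp add: binomial_row_def mult.commute[of u] coeff_monom_mult)

lemma sum_lessThan_plus: "(\<Sum>i<m + n. f i) = (\<Sum>i<m. f i) + (\<Sum>k<n. f (m + k) :: 'a::comm_monoid_add)" for m n :: nat
  by (induction n) (simp_all add: add.assoc)

lemma nonsingular_mult_mat_vec:
  fixes W :: "'a::field mat"
  assumes W: "W \<in> carrier_mat n n" and "det W \<noteq> 0"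
  shows "v \<in> carrier_vec n \<Longrightarrow> W *\<^sub>v v = 0\<^sub>v n \<Longrightarrow> v = 0\<^sub>v n"
    and "w \<in> carrier_vec n \<Longrightarrow> \<exists>v\<in>carrier_vec n. W *\<^sub>v v = w"
proof -
  show "v \<in> carrier_vec n \<Longrightarrow> W *\<^sub>v v = 0\<^sub>v n \<Longrightarrow> v = 0\<^sub>v n"
    using det_0_iff_vec_prod_zero_field[OF W] \<open>det W \<noteq> 0\<close> by blast
  assume w: "w \<in> carrier_vec n"
  from det_non_zero_imp_unit[OF W \<open>det W \<noteq> 0\<close>, of "()"]
  obtain V where V: "V \<in> carrier_mat n n" "W * V = 1\<^sub>m n"
    by (auto simp: Units_def ring_mat_def)
  have "W *\<^sub>v (V *\<^sub>v w) = w"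
    using assoc_mult_mat_vec[OF W V(1) w] V(2) w by simp
  moreover have "V *\<^sub>v w \<in> carrier_vec n" using V(1) w by simp
  ultimately show "\<exists>v\<in>carrier_vec n. W *\<^sub>v v = w" by blast
qed

lemma coeffs_below_pCons: "coeffs_below n u \<Longrightarrow> coeffs_below (Suc n) (pCons a u)"
  by (auto simp: coeffs_below_def coeff_pCons split: nat.split)

lemma combination_add: "combination b c \<beta> \<gamma> (u1 + v1) (u2 + v2) (u3 + v3) (u4 + v4)
    = combination b c \<beta> \<gamma> u1 u2 u3 u4 + combination b c \<beta> \<gamma> v1 v2 v3 v4"
  by (simp add: combination_def algebra_simps)

lemma combination_pCons: "combination b c \<beta> \<gamma> (pCons 0 u1) (pCons 0 u2) (pCons 0 u3) (pCons 0 u4)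
    = pCons 0 (combination b c \<beta> \<gamma> u1 u2 u3 u4)"
  by (simp add: combination_def)

context
  fixes A B M \<alpha> \<beta> n :: nat and W :: "'k::field mat"
  assumes char: "CHAR('k) = 0 \<or> A + B + n \<le> CHAR('k)" and n: "n = \<alpha> + \<beta> + M"
  defines "W \<equiv> transpose_mat (map_mat of_int (N_matrix_nat A B M \<alpha> \<beta>))"
begin

lemma W_carrier: "W \<in> carrier_mat n n"
  by (simp add: W_def N_matrix_nat_def n)

lemma det_W: "det W \<noteq> 0"
proof -
  have "det W = of_int (det (N_matrix_nat A B M \<alpha> \<beta>))"
    unfolding W_def
    by (subst det_transpose[of _ n]) (simp_all add: N_matrix_nat_def n of_int_hom.hom_det)
  with det_binomial_toeplitz_neq_0[OF char] show ?thesis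
    by (simp add: det_N_matrix_nat n)
qed

text \<open>
  The vector \<open>v\<close> lists the coefficients of \<open>u\<close> followed by those of \<open>w\<close>. Transposition of \<open>N\<close>
  makes the product with \<open>v\<close> a combination of the rows of \<open>N\<close>, that is, of windows of coefficients.
\<close>

lemma W_mult_vec:
  fixes u w :: "'k poly" and v :: "'k vec"
  assumes "coeffs_below (\<alpha> + \<beta>) u" "coeffs_below M w" "j < n"
    and v: "v \<in> carrier_vec n" "\<And>i. i < \<alpha> + \<beta> \<Longrightarrow> v $ i = coeff u i"
      "\<And>k. k < M \<Longrightarrow> v $ (\<alpha> + \<beta> + k) = coeff w k"
  shows "(W *\<^sub>v v) $ j = coeff (u * binomial_row 0 (A + B + M) + w * binomial_row \<beta> (A + B)) (A + j)"
proof -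
  have "(W *\<^sub>v v) $ j = (\<Sum>i<n. of_int (N_matrix_nat A B M \<alpha> \<beta> $$ (i, j)) * v $ i)"
    using assms(3) v(1)
    by (auto simp: W_def N_matrix_nat_def n scalar_prod_def lessThan_atLeast0 intro!: sum.cong)
  also have "\<dots> = (\<Sum>i<\<alpha> + \<beta>. coeff u i * coeff (binomial_row (0 + i) (A + B + M)) (A + j))
      + (\<Sum>k<M. coeff w k * coeff (binomial_row (\<beta> + k) (A + B)) (A + j))"
    unfolding n sum_lessThan_plus[of _ "\<alpha> + \<beta>"]
    using assms(3) by (intro arg_cong2[of _ _ _ _ "(+)"] sum.cong refl)
      (auto simp: N_matrix_nat_def v n coeff_binomial_row mult.commute)
  also have "\<dots> = coeff (u * binomial_row 0 (A + B + M) + w * binomial_row \<beta> (A + B)) (A + j)"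
    using assms(1,2)
    by (simp only: coeff_add coeff_mult_binomial_row[of "\<alpha> + \<beta>" u] coeff_mult_binomial_row[of M w]
        coeffs_below_def)
  finally show ?thesis .
qed

text \<open>
  The summands \<open>u1\<close> and \<open>T^(A + n) u2\<close> do not meet the window \<open>A, ..., A + n - 1\<close>. The coefficients
  in the window force \<open>u3\<close> and \<open>u4\<close> to vanish because \<open>W\<close> is nonsingular; what remains has no
  overlapping terms.
\<close>

lemma combination_eq_0:
  fixes u1 u2 u3 u4 :: "'k poly"
  assumes "coeffs_below A u1" "coeffs_below B u2" "coeffs_below (\<alpha> + \<beta>) u3" "coeffs_below M u4"
    and 0: "combination (A + n) (A + B + M) \<beta> (A + B) u1 u2 u3 u4 = 0"
  shows "u1 = 0 \<and> u2 = 0 \<and> u3 = 0 \<and> u4 = 0"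
proof -
  let ?v = "vec n (\<lambda>i. if i < \<alpha> + \<beta> then coeff u3 i else coeff u4 (i - (\<alpha> + \<beta>)))"
  have coeff0: "coeff (u3 * binomial_row 0 (A + B + M) + u4 * binomial_row \<beta> (A + B)) k
      = - coeff u1 k - coeff (u2 * binomial_row (A + n) 0) k" for k
  proof -
    have "coeff (combination (A + n) (A + B + M) \<beta> (A + B) u1 u2 u3 u4) k = 0" by (simp add: 0)
    then show ?thesis by (simp add: combination_def algebra_simps add_eq_0_iff)
  qed
  have "(W *\<^sub>v ?v) $ j = 0" if "j < n" for j
  proof -
    have "(W *\<^sub>v ?v) $ j = coeff (u3 * binomial_row 0 (A + B + M) + u4 * binomial_row \<beta> (A + B)) (A + j)"
      using assms that by (intro W_mult_vec) (auto simp: n)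
    also have "\<dots> = 0"
      using assms(1) that unfolding coeff0 by (simp add: coeff_mult_binomial_row_0 coeffs_below_def)
    finally show ?thesis .
  qed
  then have "W *\<^sub>v ?v = 0\<^sub>v n" using W_carrier by (intro eq_vecI) auto
  with nonsingular_mult_mat_vec(1)[OF W_carrier det_W, of ?v] have v0: "?v = 0\<^sub>v n" by simp
  have v: "?v $ i = 0" if "i < n" for i using that unfolding v0 by simp
  have "coeff u3 i = 0" for i
    using assms(3) v[of i] by (cases "i < \<alpha> + \<beta>") (auto simp: n coeffs_below_def)
  then have "u3 = 0" by (intro poly_eqI) simp
  have "coeff u4 i = 0" for i
    using assms(4) v[of "\<alpha> + \<beta> + i"] by (cases "i < M") (auto simp: n coeffs_below_def)
  then have "u4 = 0" by (intro poly_eqI) simp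
  have *: "coeff u1 k + coeff (u2 * binomial_row (A + n) 0) k = 0" for k
    using coeff0[of k] by (simp add: \<open>u3 = 0\<close> \<open>u4 = 0\<close>) (metis add.right_inverse)
  have "coeff u1 k = 0" for k
    using *[of k] assms(1) by (cases "k < A") (auto simp: coeff_mult_binomial_row_0 coeffs_below_def)
  moreover have "coeff u2 k = 0" for k
    using *[of "A + n + k"] calculation[of "A + n + k"] by (simp add: coeff_mult_binomial_row_0)
  ultimately show ?thesis using \<open>u3 = 0\<close> \<open>u4 = 0\<close> by (auto intro: poly_eqI)
qed

text \<open>
  Solve for \<open>u3\<close> and \<open>u4\<close> in the window; the remainder \<open>q\<close> has no terms there and splits into a
  part below \<open>A\<close> and a part from \<open>A + n\<close> on.
\<close>

lemma combination_exists_critical: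
  fixes p :: "'k poly"
  assumes "coeffs_below (A + B + n) p"
  shows "\<exists>u1 u2 u3 u4. coeffs_below A u1 \<and> coeffs_below B u2 \<and> coeffs_below (\<alpha> + \<beta>) u3 \<and>
    coeffs_below M u4 \<and> p = combination (A + n) (A + B + M) \<beta> (A + B) u1 u2 u3 u4"
proof -
  obtain v where v: "v \<in> carrier_vec n" "W *\<^sub>v v = vec n (\<lambda>j. coeff p (A + j))"
    using nonsingular_mult_mat_vec(2)[OF W_carrier det_W, of "vec n (\<lambda>j. coeff p (A + j))"] by auto
  obtain u3 where u3: "coeffs_below (\<alpha> + \<beta>) u3" "\<And>k. k < \<alpha> + \<beta> \<Longrightarrow> coeff u3 k = v $ k"
    using poly_with_coeffs[of "\<alpha> + \<beta>" "\<lambda>k. v $ k"] by auto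
  obtain u4 where u4: "coeffs_below M u4" "\<And>k. k < M \<Longrightarrow> coeff u4 k = v $ (\<alpha> + \<beta> + k)"
    using poly_with_coeffs[of M "\<lambda>k. v $ (\<alpha> + \<beta> + k)"] by auto
  define q where "q = p - (u3 * binomial_row 0 (A + B + M) + u4 * binomial_row \<beta> (A + B))"
  have middle: "coeff q (A + j) = 0" if "j < n" for j
  proof -
    have "coeff p (A + j) = (W *\<^sub>v v) $ j" using v that by simp
    also have "\<dots> = coeff (u3 * binomial_row 0 (A + B + M) + u4 * binomial_row \<beta> (A + B)) (A + j)"
      using u3 u4 v(1) that by (intro W_mult_vec) auto
    finally show ?thesis by (simp add: q_def)
  qed
  have top: "coeff q k = 0" if "A + B + n \<le> k" for k
  proof -
    have "coeff (u3 * binomial_row 0 (A + B + M)) k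
        = (\<Sum>i<\<alpha> + \<beta>. coeff u3 i * coeff (binomial_row (0 + i) (A + B + M)) k)"
      using u3(1) by (intro coeff_mult_binomial_row) (simp add: coeffs_below_def)
    also have "\<dots> = 0"
      using that by (intro sum.neutral) (auto simp: n coeff_binomial_row int_binomial_def)
    finally have 1: "coeff (u3 * binomial_row 0 (A + B + M)) k = 0" .
    have "coeff (u4 * binomial_row \<beta> (A + B)) k
        = (\<Sum>i<M. coeff u4 i * coeff (binomial_row (\<beta> + i) (A + B)) k)"
      using u4(1) by (intro coeff_mult_binomial_row) (simp add: coeffs_below_def)
    also have "\<dots> = 0"
      using that by (intro sum.neutral) (auto simp: n coeff_binomial_row int_binomial_def)
    finally show ?thesis using 1 assms that by (simp add: q_def coeffs_below_def)
  qed
  obtain u1 where u1: "coeffs_below A u1" "\<And>k. k < A \<Longrightarrow> coeff u1 k = coeff q k"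
    using poly_with_coeffs[of A "coeff q"] by auto
  obtain u2 where u2: "coeffs_below B u2" "\<And>k. k < B \<Longrightarrow> coeff u2 k = coeff q (A + n + k)"
    using poly_with_coeffs[of B "\<lambda>k. coeff q (A + n + k)"] by auto
  have "coeff q k = coeff (u1 + u2 * binomial_row (A + n) 0) k" for k
  proof -
    consider "k < A" | "A \<le> k" "k < A + n" | "A + n \<le> k" "k < A + n + B" | "A + B + n \<le> k"
      by linarith
    then show ?thesis
    proof cases
      case 2
      then show ?thesis
        using middle[of "k - A"] u1(1) by (simp add: coeff_mult_binomial_row_0 coeffs_below_def)
    next
      case 3
      then show ?thesis
        using u1(1) u2(2)[of "k - (A + n)"] by (simp add: coeff_mult_binomial_row_0 coeffs_below_def)
    next
      case 4
      then show ?thesis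
        using u1(1) u2(1) top by (simp add: coeff_mult_binomial_row_0 coeffs_below_def)
    qed (simp add: u1 coeff_mult_binomial_row_0)
  qed
  then have "q = u1 + u2 * binomial_row (A + n) 0" by (rule poly_eqI)
  then have "p = combination (A + n) (A + B + M) \<beta> (A + B) u1 u2 u3 u4"
    by (simp add: q_def combination_def algebra_simps)
  with u1 u2 u3 u4 show ?thesis by blast
qed

text \<open>
  Split off the constant term, \<open>p = p0 + T p1\<close>. Both \<open>p0\<close> and \<open>p1\<close> are combinations under the
  previous bounds, and multiplication by \<open>T\<close> raises each bound by one.
\<close>

lemma combination_exists:
  fixes p :: "'k poly"
  assumes "coeffs_below (A + B + n + t) p" "0 < A + B + n"
  shows "\<exists>u1 u2 u3 u4. coeffs_below (A + t) u1 \<and> coeffs_below (B + t) u2 \<and>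
    coeffs_below (\<alpha> + \<beta> + t) u3 \<and> coeffs_below (M + t) u4 \<and>
    p = combination (A + n) (A + B + M) \<beta> (A + B) u1 u2 u3 u4"
  using assms(1)
proof (induction t arbitrary: p)
  case 0
  then show ?case using combination_exists_critical[of p] by simp
next
  case (Suc t)
  obtain p0 p1 where p: "p = pCons p0 p1" by (cases p)
  have "coeffs_below (A + B + n + t) p1"
    unfolding coeffs_below_def
  proof (intro allI impI)
    fix k assume "A + B + n + t \<le> k"
    then show "coeff p1 k = 0"
      using Suc.prems unfolding coeffs_below_def p by (auto dest: spec[of _ "Suc k"])
  qed
  from Suc.IH[OF this] obtain u1 u2 u3 u4 where u: "coeffs_below (A + t) u1" "coeffs_below (B + t) u2"
    "coeffs_below (\<alpha> + \<beta> + t) u3" "coeffs_below (M + t) u4"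
    "p1 = combination (A + n) (A + B + M) \<beta> (A + B) u1 u2 u3 u4" by blast
  have "coeffs_below (A + B + n + t) [:p0:]"
    using assms(2) by (auto simp: coeffs_below_def coeff_pCons split: nat.split)
  from Suc.IH[OF this] obtain v1 v2 v3 v4 where v: "coeffs_below (A + t) v1" "coeffs_below (B + t) v2"
    "coeffs_below (\<alpha> + \<beta> + t) v3" "coeffs_below (M + t) v4"
    "[:p0:] = combination (A + n) (A + B + M) \<beta> (A + B) v1 v2 v3 v4" by blast
  have below: "coeffs_below (m + Suc t) (v + pCons 0 u)"
    if "coeffs_below (m + t) u" "coeffs_below (m + t) v" for m and u v :: "'k poly"
    using coeffs_below_pCons[OF that(1), of 0] that(2) by (simp add: coeffs_below_def)
  have "p = [:p0:] + pCons 0 p1" by (simp add: p)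
  also have "\<dots> = combination (A + n) (A + B + M) \<beta> (A + B)
      (v1 + pCons 0 u1) (v2 + pCons 0 u2) (v3 + pCons 0 u3) (v4 + pCons 0 u4)"
    by (simp only: u(5) v(5) combination_add combination_pCons)
  finally show ?case using below u(1-4) v(1-4) by blast
qed

end

section \<open>Restriction of forms in three variables to a line\<close>

text \<open>
  A linear order on the variables yields a linear order on the monomials that is compatible with
  multiplication. By comparison of leading terms the polynomial ring then has no zero divisors, and
  the linear form can be cancelled.
\<close>

instantiation xyz :: linorder
begin

primrec xyz_rank :: "xyz \<Rightarrow> nat" where
  "xyz_rank Var_x = 0" | "xyz_rank Var_y = 1" | "xyz_rank Var_z = 2"

definition less_eq_xyz :: "xyz \<Rightarrow> xyz \<Rightarrow> bool" where
  "v \<le> w \<longleftrightarrow> xyz_rank v \<le> xyz_rank w"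

definition less_xyz :: "xyz \<Rightarrow> xyz \<Rightarrow> bool" where
  "v < w \<longleftrightarrow> xyz_rank v < xyz_rank w"

instance
proof
  fix v w :: xyz
  show "v \<le> w \<Longrightarrow> w \<le> v \<Longrightarrow> v = w"
    by (cases v; cases w) (simp_all add: less_eq_xyz_def)
qed (auto simp: less_eq_xyz_def less_xyz_def)

end

abbreviation pm_lookup :: "('a \<Rightarrow>\<^sub>0 'b::zero) \<Rightarrow> 'a \<Rightarrow> 'b" where
  "pm_lookup \<equiv> Poly_Mapping.lookup"

definition exponent :: "nat \<Rightarrow> nat \<Rightarrow> nat \<Rightarrow> (xyz \<Rightarrow>\<^sub>0 nat)" where
  "exponent i j k = Poly_Mapping.single Var_x i + Poly_Mapping.single Var_y j + Poly_Mapping.single Var_z k"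

lemma lookup_exponent [simp]:
  "pm_lookup (exponent i j k) Var_x = i"
  "pm_lookup (exponent i j k) Var_y = j"
  "pm_lookup (exponent i j k) Var_z = k"
  by (simp_all add: exponent_def lookup_add lookup_single when_def)

lemma exponent_surj: "exponent (pm_lookup m Var_x) (pm_lookup m Var_y) (pm_lookup m Var_z) = m"
proof (rule poly_mapping_eqI)
  show "pm_lookup (exponent (pm_lookup m Var_x) (pm_lookup m Var_y) (pm_lookup m Var_z)) v
    = pm_lookup m v" for v by (cases v) simp_all
qed

lemma exponent_add: "exponent i j k + exponent i' j' k' = exponent (i + i') (j + j') (k + k')"
  by (simp add: exponent_def single_add add_ac)

lemma monomial3_eq: "monomial3 i j k = Poly_Mapping.single (exponent i j k) 1"
  by (simp add: monomial3_def exponent_def)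

lemma poly_mapping_sum_singles:
  fixes f :: "'a \<Rightarrow>\<^sub>0 'b::comm_monoid_add"
  shows "(\<Sum>m\<in>Poly_Mapping.keys f. Poly_Mapping.single m (pm_lookup f m)) = f"
  by (rule poly_mapping_eqI)
    (simp add: lookup_sum lookup_single when_def not_in_keys_iff_lookup_eq_zero)

lemma sum_of_monomials_induct:
  fixes f :: "'a \<Rightarrow>\<^sub>0 'b::comm_monoid_add"
  assumes "P 0" "\<And>f g. P f \<Longrightarrow> P g \<Longrightarrow> P (f + g)"
    and "\<And>m. m \<in> Poly_Mapping.keys f \<Longrightarrow> P (Poly_Mapping.single m (pm_lookup f m))"
  shows "P f"
proof -
  have "P (\<Sum>m\<in>S. Poly_Mapping.single m (pm_lookup f m))"
    if "finite S" "S \<subseteq> Poly_Mapping.keys f" for S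
    using that by (induction S rule: finite_induct) (auto intro: assms)
  from this[OF finite_keys order.refl] show ?thesis
    by (simp add: poly_mapping_sum_singles)
qed

definition total_degree :: "(xyz \<Rightarrow>\<^sub>0 nat) \<Rightarrow> nat" where
  "total_degree m = pm_lookup m Var_x + pm_lookup m Var_y + pm_lookup m Var_z"

lemma total_degree_add: "total_degree (m + m') = total_degree m + total_degree m'"
  by (simp add: total_degree_def lookup_add)

lemma total_degree_exponent [simp]: "total_degree (exponent i j k) = i + j + k"
  by (simp add: total_degree_def)

lemma homogeneous_iff: "f \<in> homogeneous d \<longleftrightarrow> (\<forall>m\<in>Poly_Mapping.keys f. int (total_degree m) = d)"
  by (simp add: homogeneous_def total_degree_def)

lemma homogeneous_0 [simp]: "0 \<in> homogeneous d"
  by (simp add: homogeneous_iff)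

lemma homogeneous_add: "f \<in> homogeneous d \<Longrightarrow> g \<in> homogeneous d \<Longrightarrow> f + g \<in> homogeneous d"
  using keys_add[of f g] by (auto simp: homogeneous_iff)

lemma homogeneous_uminus: "f \<in> homogeneous d \<Longrightarrow> - f \<in> homogeneous d"
  by (simp add: homogeneous_iff in_keys_iff)

lemma homogeneous_diff: "f \<in> homogeneous d \<Longrightarrow> g \<in> homogeneous d \<Longrightarrow> f - g \<in> homogeneous d"
  using homogeneous_add[of f d "- g"] homogeneous_uminus[of g d] by simp

lemma homogeneous_single: "int (total_degree m) = d \<Longrightarrow> Poly_Mapping.single m c \<in> homogeneous d"
  by (simp add: homogeneous_iff)

lemma homogeneous_mult:
  assumes "f \<in> homogeneous d" "g \<in> homogeneous e"
  shows "f * g \<in> homogeneous (d + e)"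
  unfolding homogeneous_iff
proof
  fix m assume "m \<in> Poly_Mapping.keys (f * g)"
  then obtain m1 m2 where "m = m1 + m2" "m1 \<in> Poly_Mapping.keys f" "m2 \<in> Poly_Mapping.keys g"
    using keys_mult[of f g] by auto
  then show "int (total_degree m) = d + e"
    using assms by (auto simp: homogeneous_iff total_degree_add)
qed

lemma homogeneous_sum: "(\<And>i. i \<in> S \<Longrightarrow> f i \<in> homogeneous d) \<Longrightarrow> sum f S \<in> homogeneous d"
  by (induction S rule: infinite_finite_induct) (auto intro: homogeneous_add)

text \<open>
  Substitution of \<open>x = 1\<close>, \<open>y = T\<close>, \<open>z = 1 + T\<close>, the restriction to a line parametrized inside the
  plane \<open>z = x + y\<close>. A form is determined on that plane by its restriction to the line.
\<close>

definition restrict_line :: "'k::field poly3 \<Rightarrow> 'k poly" where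
  "restrict_line f = (\<Sum>m\<in>Poly_Mapping.keys f.
     smult (pm_lookup f m) (binomial_row (pm_lookup m Var_y) (pm_lookup m Var_z)))"

lemma restrict_line_superset:
  assumes "finite S" "Poly_Mapping.keys f \<subseteq> S"
  shows "restrict_line f = (\<Sum>m\<in>S. smult (pm_lookup f m)
    (binomial_row (pm_lookup m Var_y) (pm_lookup m Var_z)))"
  unfolding restrict_line_def
  using assms by (intro sum.mono_neutral_left) (auto simp: not_in_keys_iff_lookup_eq_zero)

lemma restrict_line_0 [simp]: "restrict_line 0 = 0"
  by (simp add: restrict_line_def)

lemma restrict_line_add: "restrict_line (f + g) = restrict_line f + restrict_line g"
proof -
  let ?S = "Poly_Mapping.keys f \<union> Poly_Mapping.keys g"
  have "Poly_Mapping.keys (f + g) \<subseteq> ?S" by (rule keys_add)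
  then show ?thesis
    by (simp add: restrict_line_superset[of ?S] lookup_add smult_add_left sum.distrib)
qed

lemma restrict_line_diff: "restrict_line (f - g) = restrict_line f - restrict_line g"
  using restrict_line_add[of "f - g" g] by simp

lemma restrict_line_sum: "restrict_line (sum f S) = (\<Sum>i\<in>S. restrict_line (f i))"
  by (induction S rule: infinite_finite_induct) (simp_all add: restrict_line_add)

lemma restrict_line_single: "restrict_line (Poly_Mapping.single m c)
    = smult c (binomial_row (pm_lookup m Var_y) (pm_lookup m Var_z))"
  by (subst restrict_line_superset[of "{m}"]) auto

lemma restrict_line_monomial3_mult:
  "restrict_line (monomial3 i j k * f) = restrict_line f * binomial_row j k"
proof (rule sum_of_monomials_induct[of _ f])
  show "restrict_line (monomial3 i j k * Poly_Mapping.single m (pm_lookup f m))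
    = restrict_line (Poly_Mapping.single m (pm_lookup f m)) * binomial_row j k" for m
    by (simp add: monomial3_eq mult_single restrict_line_single lookup_add binomial_row_mult add.commute)
qed (simp_all add: distrib_left distrib_right restrict_line_add)

definition linear_form :: "'k::field poly3" where
  "linear_form = monomial3 0 0 1 - monomial3 1 0 0 - monomial3 0 1 0"

lemma homogeneous_monomial3: "monomial3 i j k \<in> homogeneous (int (i + j + k))"
  unfolding monomial3_eq by (rule homogeneous_single) simp

lemma homogeneous_linear_form: "linear_form \<in> homogeneous 1"
  unfolding linear_form_def
  using homogeneous_monomial3[of 1 0 0] homogeneous_monomial3[of 0 1 0] homogeneous_monomial3[of 0 0 1]
  by (auto intro!: homogeneous_diff)

lemma linear_form_neq_0: "(linear_form :: 'k::field poly3) \<noteq> 0"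
proof
  assume "(linear_form :: 'k poly3) = 0"
  then have "pm_lookup (linear_form :: 'k poly3) (exponent 0 0 1) = 0" by simp
  moreover have "exponent 1 0 0 \<noteq> exponent 0 0 1" "exponent 0 1 0 \<noteq> exponent 0 0 1"
    by (metis lookup_exponent(3) zero_neq_one)+
  ultimately show False by (simp add: linear_form_def monomial3_eq lookup_minus lookup_single)
qed

lemma binomial_row_Pascal: "binomial_row j (Suc k) = binomial_row j k + binomial_row (Suc j) k"
proof -
  have "[:1, 1:] = 1 + (monom 1 1 :: 'a poly)" by (simp add: monom_altdef one_pCons)
  moreover have "monom 1 (Suc j) = (monom 1 j * monom 1 1 :: 'a poly)" by (simp add: mult_monom)
  ultimately show ?thesis by (simp add: binomial_row_def algebra_simps)
qed

lemma restrict_line_linear_form_mult: "restrict_line (linear_form * g) = 0"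
proof -
  have "linear_form * g = monomial3 0 0 1 * g - monomial3 1 0 0 * g - monomial3 0 1 0 * g"
    by (simp add: linear_form_def left_diff_distrib)
  then have "restrict_line (linear_form * g) = restrict_line g
      * (binomial_row 0 (Suc 0) - binomial_row 0 0 - binomial_row (Suc 0) 0)"
    by (simp only: restrict_line_diff restrict_line_monomial3_mult right_diff_distrib One_nat_def)
  then show ?thesis
    by (simp only: binomial_row_Pascal) simp
qed

lemma coeffs_below_restrict_line:
  assumes "f \<in> homogeneous d"
  shows "coeffs_below (nat (d + 1)) (restrict_line f)"
  unfolding coeffs_below_def
proof (intro allI impI)
  fix k assume k: "nat (d + 1) \<le> k"
  show "coeff (restrict_line f) k = 0"
    unfolding restrict_line_def coeff_sum coeff_smult
  proof (intro sum.neutral ballI)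
    fix m assume "m \<in> Poly_Mapping.keys f"
    with assms have "int (total_degree m) = d" by (auto simp: homogeneous_iff)
    with k have "pm_lookup m Var_y + pm_lookup m Var_z < k" by (simp add: total_degree_def)
    then show "pm_lookup f m * coeff (binomial_row (pm_lookup m Var_y) (pm_lookup m Var_z)) k = 0"
      by (simp add: coeff_binomial_row int_binomial_def)
  qed
qed

text \<open>
  The form of degree \<open>d\<close> in \<open>x\<close> and \<open>y\<close> alone whose restriction is \<open>p\<close>; coefficients of \<open>p\<close>
  beyond \<open>d\<close> are dropped, and for negative \<open>d\<close> the sum is empty.
\<close>

definition homogenize :: "int \<Rightarrow> 'k::field poly \<Rightarrow> 'k poly3" where
  "homogenize d p = (\<Sum>k<nat (d + 1). Poly_Mapping.single (exponent (nat d - k) k 0) (coeff p k))"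

lemma homogenize_homogeneous: "homogenize d p \<in> homogeneous d"
  unfolding homogenize_def by (intro homogeneous_sum homogeneous_single) auto

lemma homogenize_0 [simp]: "homogenize d 0 = 0"
  by (simp add: homogenize_def)

lemma homogenize_add: "homogenize d (p + q) = homogenize d p + homogenize d q"
  by (simp add: homogenize_def single_add sum.distrib)

lemma restrict_line_homogenize:
  assumes "coeffs_below (nat (d + 1)) p"
  shows "restrict_line (homogenize d p) = p"
proof -
  have "restrict_line (homogenize d p) = (\<Sum>k<nat (d + 1). monom (coeff p k) k)"
    by (simp add: homogenize_def restrict_line_sum restrict_line_single binomial_row_def smult_monom)
  also have "\<dots> = p"
    using assms by (intro poly_eqI) (auto simp: coeff_sum coeff_monom coeffs_below_def)
  finally show ?thesis .
qed

lemma homogenize_monom: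
  "homogenize (int (i + j)) (smult c (binomial_row j 0)) = Poly_Mapping.single (exponent i j 0) c"
proof -
  have "homogenize (int (i + j)) (smult c (binomial_row j 0))
      = (\<Sum>k<Suc (i + j). if k = j then Poly_Mapping.single (exponent i j 0) c else 0)"
    unfolding homogenize_def
    by (intro sum.cong) (auto simp: binomial_row_def smult_monom coeff_monom nat_add_distrib)
  then show ?thesis by simp
qed

text \<open>
  \<open>f\<close> is congruent modulo the linear form to the form in \<open>x\<close> and \<open>y\<close> with the same restriction.
  The quotient \<open>g\<close> is required to be a form of degree \<open>d - 1\<close>, since it supplies the preimages under
  multiplication by the linear form.
\<close>

definition reducible_to_line :: "int \<Rightarrow> 'k::field poly3 \<Rightarrow> bool" where
  "reducible_to_line d f \<longleftrightarrow> (\<exists>g\<in>homogeneous (d - 1). f = linear_form * g + homogenize d (restrict_line f))"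

lemma reducible_to_line_0: "reducible_to_line d 0"
  unfolding reducible_to_line_def by (intro bexI[of _ 0]) auto

lemma reducible_to_line_add:
  assumes "reducible_to_line d f" "reducible_to_line d g"
  shows "reducible_to_line d (f + g)"
proof -
  from assms obtain f' g' where "f' \<in> homogeneous (d - 1)" "g' \<in> homogeneous (d - 1)"
    and f: "f = linear_form * f' + homogenize d (restrict_line f)"
    and g: "g = linear_form * g' + homogenize d (restrict_line g)"
    unfolding reducible_to_line_def by blast
  have "f + g = linear_form * (f' + g') + homogenize d (restrict_line (f + g))"
    unfolding restrict_line_add homogenize_add distrib_left
    by (subst f, subst g) (simp only: add_ac)
  with \<open>f' \<in> _\<close> \<open>g' \<in> _\<close> homogeneous_add show ?thesis
    unfolding reducible_to_line_def by blast
qed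

lemma reducible_to_line_mult:
  assumes "g \<in> homogeneous (d - 1)"
  shows "reducible_to_line d (linear_form * g)"
  unfolding reducible_to_line_def
  using assms by (intro bexI[of _ g]) (simp_all add: restrict_line_linear_form_mult)

text \<open>
  Induction on the exponent of \<open>z\<close>: one factor \<open>z\<close> is replaced by \<open>x + y\<close> modulo \<open>z - x - y\<close>.
\<close>

lemma reducible_to_line_single:
  "reducible_to_line (int (i + j + k)) (Poly_Mapping.single (exponent i j k) c)"
proof (induction k arbitrary: i j)
  case 0
  have "Poly_Mapping.single (exponent i j 0) c = linear_form * 0
      + homogenize (int (i + j + 0)) (restrict_line (Poly_Mapping.single (exponent i j 0) c))"
    using homogenize_monom[of i j c] by (simp add: restrict_line_single)
  then show ?case unfolding reducible_to_line_def by (metis homogeneous_0)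
next
  case (Suc k)
  let ?d = "int (i + j + Suc k)"
  have "Poly_Mapping.single (exponent i j (Suc k)) c
      = linear_form * Poly_Mapping.single (exponent i j k) c
        + (Poly_Mapping.single (exponent (Suc i) j k) c + Poly_Mapping.single (exponent i (Suc j) k) c)"
    by (simp add: linear_form_def monomial3_eq left_diff_distrib mult_single exponent_add)
  moreover have "reducible_to_line ?d (linear_form * Poly_Mapping.single (exponent i j k) c)"
    by (intro reducible_to_line_mult homogeneous_single) simp
  moreover have "reducible_to_line ?d (Poly_Mapping.single (exponent (Suc i) j k) c)"
    "reducible_to_line ?d (Poly_Mapping.single (exponent i (Suc j) k) c)"
    using Suc[of "Suc i" j] Suc[of i "Suc j"] by (simp_all add: add_ac)
  ultimately show ?case by (simp only: reducible_to_line_add)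
qed

lemma homogeneous_reducible_to_line:
  assumes "f \<in> homogeneous d"
  shows "reducible_to_line d f"
proof (rule sum_of_monomials_induct[of _ f])
  fix m assume "m \<in> Poly_Mapping.keys f"
  with assms have "d = int (total_degree m)" by (auto simp: homogeneous_iff)
  then show "reducible_to_line d (Poly_Mapping.single m (pm_lookup f m))"
    using reducible_to_line_single[of "pm_lookup m Var_x" "pm_lookup m Var_y" "pm_lookup m Var_z"]
    by (simp add: exponent_surj total_degree_def)
qed (auto intro: reducible_to_line_0 reducible_to_line_add)

text \<open>
  Together with \<open>restrict_line_linear_form_mult\<close>: a form vanishes on the line exactly if it is a
  multiple of the linear form.
\<close>

lemma restrict_line_eq_0D:
  assumes "f \<in> homogeneous d" "restrict_line f = 0"
  shows "\<exists>g\<in>homogeneous (d - 1). f = linear_form * g"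
  using homogeneous_reducible_to_line[OF assms(1)] assms(2) by (simp add: reducible_to_line_def)

section \<open>The weak Lefschetz property\<close>

lemma poly3_ring_simps [simp]:
  "carrier poly3_ring = UNIV" "f \<otimes>\<^bsub>poly3_ring\<^esub> g = f * g" "f \<oplus>\<^bsub>poly3_ring\<^esub> g = f + g"
  "\<zero>\<^bsub>poly3_ring\<^esub> = 0"
  by (simp_all add: ring_of_type_algebra_def)

lemma ring_poly3: "ring (poly3_ring :: 'k::field poly3 ring)"
  by (rule ring_from_type_algebra)

lemma poly3_idealD:
  fixes I :: "'k::field poly3 set"
  assumes "ideal I poly3_ring"
  shows "0 \<in> I" "f \<in> I \<Longrightarrow> g \<in> I \<Longrightarrow> f + g \<in> I" "f \<in> I \<Longrightarrow> f * g \<in> I" "f \<in> I \<Longrightarrow> - f \<in> I"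
proof -
  interpret ideal I "poly3_ring :: 'k poly3 ring" by fact
  show "0 \<in> I" using additive_subgroup.zero_closed[OF additive_subgroup_axioms] by simp
  show "f \<in> I \<Longrightarrow> g \<in> I \<Longrightarrow> f + g \<in> I" using additive_subgroup.a_closed[OF additive_subgroup_axioms, of f g] by simp
  show mult: "f \<in> I \<Longrightarrow> f * g \<in> I" for g using I_r_closed[of f g] by simp
  show "f \<in> I \<Longrightarrow> - f \<in> I" using mult[of "- 1"] by simp
qed

lemma poly3_idealI:
  fixes I :: "'k::field poly3 set"
  assumes "0 \<in> I" "\<And>f g. f \<in> I \<Longrightarrow> g \<in> I \<Longrightarrow> f + g \<in> I" "\<And>f g. f \<in> I \<Longrightarrow> f * g \<in> I"
  shows "ideal I poly3_ring"
proof -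
  interpret ring "poly3_ring :: 'k poly3 ring" by (rule ring_poly3)
  have inverse: "\<ominus>\<^bsub>poly3_ring\<^esub> f = - f" for f :: "'k poly3"
    using minus_equality[of "- f" f] by simp
  show ?thesis
  proof (rule idealI)
    show "subgroup I (add_monoid (poly3_ring :: 'k poly3 ring))"
    proof (rule add.subgroupI)
      show "\<ominus>\<^bsub>poly3_ring\<^esub> f \<in> I" if "f \<in> I" for f
        using assms(3)[OF that, of "- 1"] by (simp add: inverse)
    qed (use assms in auto)
    show "g \<otimes>\<^bsub>poly3_ring\<^esub> f \<in> I" if "f \<in> I" for f g
      using assms(3)[OF that, of g] by (simp add: mult.commute)
  qed (use assms in \<open>auto intro: ring_poly3\<close>)
qed

lemma poly3_coset_eq_iff:
  fixes I :: "'k::field poly3 set"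
  assumes I: "ideal I poly3_ring"
  shows "I +>\<^bsub>poly3_ring\<^esub> f = I +>\<^bsub>poly3_ring\<^esub> g \<longleftrightarrow> f - g \<in> I"
proof -
  have coset: "h \<in> I +>\<^bsub>poly3_ring\<^esub> f \<longleftrightarrow> h - f \<in> I" for h f
    unfolding a_r_coset_def' by (auto intro!: bexI[of _ "h - f"])
  have shift: "h - f \<in> I \<longleftrightarrow> h - g \<in> I" if "f - g \<in> I" for h
    using poly3_idealD(2)[OF I _ that, of "h - f"] poly3_idealD(2)[OF I _ poly3_idealD(4)[OF I that], of "h - g"]
    by auto
  show ?thesis
  proof
    assume "I +>\<^bsub>poly3_ring\<^esub> f = I +>\<^bsub>poly3_ring\<^esub> g"
    then have "f \<in> I +>\<^bsub>poly3_ring\<^esub> g" using poly3_idealD(1)[OF I] coset[of f f] by simp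
    then show "f - g \<in> I" by (simp add: coset)
  next
    assume "f - g \<in> I"
    then show "I +>\<^bsub>poly3_ring\<^esub> f = I +>\<^bsub>poly3_ring\<^esub> g" by (auto simp: coset shift)
  qed
qed

text \<open>
  The Lefschetz property of the quotient in terms of representatives: cosets are equal exactly if
  the difference of representatives lies in the ideal.
\<close>

lemma ideal_weak_LefschetzI:
  fixes I :: "'k::field poly3 set"
  assumes I: "ideal I poly3_ring" and l: "l \<in> homogeneous 1"
    and inj_or_surj: "\<And>d. (\<forall>f\<in>homogeneous d. l * f \<in> I \<longrightarrow> f \<in> I) \<or>
      (\<forall>h\<in>homogeneous (d + 1). \<exists>f\<in>homogeneous d. h - l * f \<in> I)"
  shows "ideal_weak_Lefschetz I"
  unfolding ideal_weak_Lefschetz_def weak_Lefschetz_def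
proof (rule bexI[of _ "I +>\<^bsub>poly3_ring\<^esub> l"], intro allI)
  let ?c = "\<lambda>f. I +>\<^bsub>poly3_ring\<^esub> f"
  have mult: "?c l \<otimes>\<^bsub>poly3_ring Quot I\<^esub> ?c f = ?c (l * f)" for f
    using ideal.rcoset_mult_add[OF I, of l f] by (simp add: FactRing_def)
  show "?c l \<in> quotient_component I 1" using l by (simp add: quotient_component_def)
  fix d
  from inj_or_surj[of d]
  show "inj_on (\<lambda>x. ?c l \<otimes>\<^bsub>poly3_ring Quot I\<^esub> x) (quotient_component I d) \<or>
    (\<lambda>x. ?c l \<otimes>\<^bsub>poly3_ring Quot I\<^esub> x) ` quotient_component I d = quotient_component I (d + 1)"
  proof
    assume inj: "\<forall>f\<in>homogeneous d. l * f \<in> I \<longrightarrow> f \<in> I"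
    have "inj_on (\<lambda>x. ?c l \<otimes>\<^bsub>poly3_ring Quot I\<^esub> x) (quotient_component I d)"
    proof (rule inj_onI)
      fix u v assume "u \<in> quotient_component I d" "v \<in> quotient_component I d"
        and eq: "?c l \<otimes>\<^bsub>poly3_ring Quot I\<^esub> u = ?c l \<otimes>\<^bsub>poly3_ring Quot I\<^esub> v"
      then obtain f g where fg: "u = ?c f" "v = ?c g" "f \<in> homogeneous d" "g \<in> homogeneous d"
        by (auto simp: quotient_component_def)
      with eq have "l * (f - g) \<in> I"
        by (simp add: mult poly3_coset_eq_iff[OF I] right_diff_distrib)
      with inj homogeneous_diff[OF fg(3,4)] have "f - g \<in> I" by blast
      then show "u = v" by (simp add: fg poly3_coset_eq_iff[OF I])
    qed
    then show ?thesis ..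
  next
    assume surj: "\<forall>h\<in>homogeneous (d + 1). \<exists>f\<in>homogeneous d. h - l * f \<in> I"
    have "(\<lambda>x. ?c l \<otimes>\<^bsub>poly3_ring Quot I\<^esub> x) ` quotient_component I d = ?c ` ((*) l ` homogeneous d)"
      by (simp add: quotient_component_def image_image mult)
    also have "\<dots> = ?c ` homogeneous (d + 1)"
    proof (intro equalityI subsetI)
      fix u assume "u \<in> ?c ` ((*) l ` homogeneous d)"
      then show "u \<in> ?c ` homogeneous (d + 1)"
        using homogeneous_mult[OF l, of _ d] by (auto simp: add.commute)
    next
      fix u assume "u \<in> ?c ` homogeneous (d + 1)"
      then obtain h where h: "u = ?c h" "h \<in> homogeneous (d + 1)" by auto
      with surj obtain f where "f \<in> homogeneous d" "h - l * f \<in> I" by blast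
      then show "u \<in> ?c ` ((*) l ` homogeneous d)"
        using poly3_coset_eq_iff[OF I, of h "l * f"] h by blast
    qed
    finally show ?thesis by (simp add: quotient_component_def)
  qed
qed

definition I_generators :: "nat \<Rightarrow> nat \<Rightarrow> nat \<Rightarrow> nat \<Rightarrow> nat \<Rightarrow> nat \<Rightarrow> (xyz \<Rightarrow>\<^sub>0 nat) set" where
  "I_generators a b c \<alpha> \<beta> \<gamma> = {exponent a 0 0, exponent 0 b 0, exponent 0 0 c, exponent \<alpha> \<beta> \<gamma>}"

definition generated ::
  "nat \<Rightarrow> nat \<Rightarrow> nat \<Rightarrow> nat \<Rightarrow> nat \<Rightarrow> nat \<Rightarrow> 'k poly3 \<Rightarrow> 'k poly3 \<Rightarrow> 'k poly3 \<Rightarrow> 'k poly3 \<Rightarrow> 'k::field poly3" where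
  "generated a b c \<alpha> \<beta> \<gamma> u1 u2 u3 u4 = monomial3 a 0 0 * u1 + monomial3 0 b 0 * u2
     + monomial3 0 0 c * u3 + monomial3 \<alpha> \<beta> \<gamma> * u4"

lemma I_ideal_eq: "I_ideal (int a) (int b) (int c) (int \<alpha>) (int \<beta>) (int \<gamma>)
    = Idl\<^bsub>poly3_ring\<^esub> ((\<lambda>t. Poly_Mapping.single t 1) ` I_generators a b c \<alpha> \<beta> \<gamma>)"
  by (simp add: I_ideal_def I_generators_def monomial3_eq)

lemma ideal_I_ideal: "ideal (I_ideal (int a) (int b) (int c) (int \<alpha>) (int \<beta>) (int \<gamma>)) poly3_ring"
  unfolding I_ideal_eq by (rule ring.genideal_ideal[OF ring_poly3]) simp

lemma generated_in_I_ideal: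
  "generated a b c \<alpha> \<beta> \<gamma> u1 u2 u3 u4 \<in> I_ideal (int a) (int b) (int c) (int \<alpha>) (int \<beta>) (int \<gamma>)"
proof -
  let ?I = "I_ideal (int a) (int b) (int c) (int \<alpha>) (int \<beta>) (int \<gamma>) :: 'a poly3 set"
  have "(\<lambda>t. Poly_Mapping.single t 1) ` I_generators a b c \<alpha> \<beta> \<gamma> \<subseteq> ?I"
    unfolding I_ideal_eq by (rule ring.genideal_self[OF ring_poly3]) simp
  then have "monomial3 a 0 0 \<in> ?I" "monomial3 0 b 0 \<in> ?I" "monomial3 0 0 c \<in> ?I"
    "monomial3 \<alpha> \<beta> \<gamma> \<in> ?I"
    by (auto simp: I_generators_def monomial3_eq)
  then show ?thesis
    unfolding generated_def by (intro poly3_idealD(2,3)[OF ideal_I_ideal])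
qed

text \<open>
  The polynomials all of whose monomials are multiples of generators form an ideal, so it contains
  the ideal that the generators span.
\<close>

lemma I_ideal_keys:
  assumes "f \<in> I_ideal (int a) (int b) (int c) (int \<alpha>) (int \<beta>) (int \<gamma>)" "m \<in> Poly_Mapping.keys f"
  shows "\<exists>t\<in>I_generators a b c \<alpha> \<beta> \<gamma>. \<exists>m'. m = t + m'"
proof -
  let ?J = "{f :: 'a poly3. \<forall>m\<in>Poly_Mapping.keys f. \<exists>t\<in>I_generators a b c \<alpha> \<beta> \<gamma>. \<exists>m'. m = t + m'}"
  have "ideal ?J poly3_ring"
  proof (rule poly3_idealI)
    fix f h :: "'a poly3" assume f: "f \<in> ?J"
    show "f + h \<in> ?J" if "h \<in> ?J" using f that keys_add[of f h] by blast
    show "f * h \<in> ?J"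
    proof (intro CollectI ballI)
      fix m assume "m \<in> Poly_Mapping.keys (f * h)"
      then obtain m1 m2 where m: "m = m1 + m2" "m1 \<in> Poly_Mapping.keys f" using keys_mult[of f h] by auto
      with f obtain t m' where "t \<in> I_generators a b c \<alpha> \<beta> \<gamma>" "m1 = t + m'" by blast
      with m show "\<exists>t\<in>I_generators a b c \<alpha> \<beta> \<gamma>. \<exists>m'. m = t + m'"
        by (auto intro!: bexI[of _ t] exI[of _ "m' + m2"] simp: add.assoc)
    qed
  qed simp
  moreover have "(\<lambda>t. Poly_Mapping.single t 1) ` I_generators a b c \<alpha> \<beta> \<gamma> \<subseteq> ?J"
    by (auto intro!: exI[of _ 0])
  ultimately have "I_ideal (int a) (int b) (int c) (int \<alpha>) (int \<beta>) (int \<gamma>) \<subseteq> ?J"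
    unfolding I_ideal_eq by (rule ring.genideal_minimal[OF ring_poly3])
  with assms show ?thesis by blast
qed

text \<open>
  The ideal is generated by monomials, so every monomial of \<open>f\<close> can be assigned to one generator
  dividing it. The cofactors obtained in this way are forms of the expected degrees, which
  the general description of a generated ideal does not provide.
\<close>

lemma I_ideal_homogeneous:
  fixes f :: "'k::field poly3"
  assumes f: "f \<in> I_ideal (int a) (int b) (int c) (int \<alpha>) (int \<beta>) (int \<gamma>)" "f \<in> homogeneous d"
  shows "\<exists>u1 u2 u3 u4. u1 \<in> homogeneous (d - int a) \<and> u2 \<in> homogeneous (d - int b) \<and>
    u3 \<in> homogeneous (d - int c) \<and> u4 \<in> homogeneous (d - int (\<alpha> + \<beta> + \<gamma>)) \<and>
    f = generated a b c \<alpha> \<beta> \<gamma> u1 u2 u3 u4" (is "?P f")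
proof (rule sum_of_monomials_induct[of ?P f])
  show "?P 0" by (intro exI[of _ 0]) (simp add: generated_def)
next
  fix p q :: "'k poly3" assume "?P p" "?P q"
  then obtain u1 u2 u3 u4 v1 v2 v3 v4 where
    "u1 \<in> homogeneous (d - int a)" "u2 \<in> homogeneous (d - int b)"
    "u3 \<in> homogeneous (d - int c)" "u4 \<in> homogeneous (d - int (\<alpha> + \<beta> + \<gamma>))"
    "v1 \<in> homogeneous (d - int a)" "v2 \<in> homogeneous (d - int b)"
    "v3 \<in> homogeneous (d - int c)" "v4 \<in> homogeneous (d - int (\<alpha> + \<beta> + \<gamma>))"
    "p = generated a b c \<alpha> \<beta> \<gamma> u1 u2 u3 u4" "q = generated a b c \<alpha> \<beta> \<gamma> v1 v2 v3 v4"
    by blast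
  moreover have "generated a b c \<alpha> \<beta> \<gamma> (u1 + v1) (u2 + v2) (u3 + v3) (u4 + v4)
    = generated a b c \<alpha> \<beta> \<gamma> u1 u2 u3 u4 + generated a b c \<alpha> \<beta> \<gamma> v1 v2 v3 v4"
    by (simp add: generated_def algebra_simps)
  ultimately show "?P (p + q)"
    by (intro exI[of _ "u1 + v1"] exI[of _ "u2 + v2"] exI[of _ "u3 + v3"] exI[of _ "u4 + v4"])
      (simp add: homogeneous_add)
next
  fix m assume m: "m \<in> Poly_Mapping.keys f"
  with f obtain t m' where t: "t \<in> I_generators a b c \<alpha> \<beta> \<gamma>" "m = t + m'"
    using I_ideal_keys by blast
  let ?u = "Poly_Mapping.single m' (pm_lookup f m)"
  have eq: "Poly_Mapping.single m (pm_lookup f m) = Poly_Mapping.single t 1 * ?u"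
    by (simp add: mult_single t)
  have "int (total_degree m) = d" using f(2) m by (auto simp: homogeneous_iff)
  then have u: "?u \<in> homogeneous (d - int (total_degree t))"
    by (intro homogeneous_single) (simp add: t total_degree_add)
  from t(1) consider "t = exponent a 0 0" | "t = exponent 0 b 0" | "t = exponent 0 0 c"
    | "t = exponent \<alpha> \<beta> \<gamma>" by (auto simp: I_generators_def)
  then show "?P (Poly_Mapping.single m (pm_lookup f m))"
  proof cases
    case 1
    with u eq show ?thesis
      by (intro exI[of _ ?u] exI[of _ 0]) (simp add: generated_def monomial3_eq)
  next
    case 2
    with u eq show ?thesis
      by (intro exI[of _ 0] exI[of _ ?u] conjI exI[of _ 0]) (simp_all add: generated_def monomial3_eq)
  next
    case 3
    show ?thesis
      by (rule exI[of _ 0], rule exI[of _ 0], rule exI[of _ ?u], rule exI[of _ 0])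
        (use u eq 3 in \<open>simp add: generated_def monomial3_eq\<close>)
  next
    case 4
    show ?thesis
      by (rule exI[of _ 0], rule exI[of _ 0], rule exI[of _ 0], rule exI[of _ ?u])
        (use u eq 4 in \<open>simp add: generated_def monomial3_eq\<close>)
  qed
qed

lemma restrict_line_generated: "restrict_line (generated a b c \<alpha> \<beta> \<gamma> u1 u2 u3 u4)
    = combination b c \<beta> \<gamma> (restrict_line u1) (restrict_line u2) (restrict_line u3) (restrict_line u4)"
  by (simp only: generated_def combination_def restrict_line_add restrict_line_monomial3_mult)

text \<open>
  With \<open>s + 2 = A + B + n\<close>, multiplication by \<open>z - x - y\<close> is injective in the degrees \<open>d \<le> s\<close> and
  surjective in the degrees \<open>d > s\<close>. In the first case the bounds on the cofactors are at most
  \<open>A\<close>, \<open>B\<close>, \<open>\<alpha> + \<beta>\<close> and \<open>M\<close>; in the second case each of them exceeds these numbers by the same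
  amount \<open>t\<close>.
\<close>

lemma ideal_weak_Lefschetz_I_ideal:
  fixes A B M \<alpha> \<beta> n :: nat
  assumes char: "CHAR('k::field) = 0 \<or> A + B + n \<le> CHAR('k)" and n: "n = \<alpha> + \<beta> + M" and "0 < A + B + n"
  shows "ideal_weak_Lefschetz (I_ideal (int (B + n)) (int (A + n)) (int (A + B + M))
    (int \<alpha>) (int \<beta>) (int (A + B)) :: 'k poly3 set)"
    (is "ideal_weak_Lefschetz ?I")
proof (rule ideal_weak_LefschetzI[OF ideal_I_ideal homogeneous_linear_form])
  fix d :: int
  let ?gen = "generated (B + n) (A + n) (A + B + M) \<alpha> \<beta> (A + B) :: 'k poly3 \<Rightarrow> _"
  show "(\<forall>f\<in>homogeneous d. linear_form * f \<in> ?I \<longrightarrow> f \<in> ?I) \<or>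
    (\<forall>h\<in>homogeneous (d + 1). \<exists>f\<in>homogeneous d. h - linear_form * f \<in> ?I)"
  proof (cases "d + 2 \<le> int (A + B + n)")
    case True
    have "f \<in> ?I" if f: "f \<in> homogeneous d" "linear_form * f \<in> ?I" for f
    proof -
      have "linear_form * f \<in> homogeneous (d + 1)"
        using homogeneous_mult[OF homogeneous_linear_form f(1)] by (simp add: add.commute)
      from I_ideal_homogeneous[OF f(2) this]
      obtain u1 u2 u3 u4 where
        u: "u1 \<in> homogeneous (d + 1 - int (B + n))" "u2 \<in> homogeneous (d + 1 - int (A + n))"
          "u3 \<in> homogeneous (d + 1 - int (A + B + M))" "u4 \<in> homogeneous (d + 1 - int (\<alpha> + \<beta> + (A + B)))"
        and lf: "linear_form * f = ?gen u1 u2 u3 u4" by blast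
      have "restrict_line u1 = 0 \<and> restrict_line u2 = 0 \<and> restrict_line u3 = 0 \<and> restrict_line u4 = 0"
      proof (rule combination_eq_0[OF char n])
        show "combination (A + n) (A + B + M) \<beta> (A + B)
          (restrict_line u1) (restrict_line u2) (restrict_line u3) (restrict_line u4) = 0"
          by (simp only: restrict_line_generated[symmetric, where a = "B + n" and \<alpha> = \<alpha>] lf[symmetric]
              restrict_line_linear_form_mult)
      qed (rule coeffs_below_mono[OF coeffs_below_restrict_line], rule u, use True n in linarith)+
      then obtain v1 v2 v3 v4 where "u1 = linear_form * v1" "u2 = linear_form * v2"
        "u3 = linear_form * v3" "u4 = linear_form * v4"
        using u restrict_line_eq_0D by metis
      then have "linear_form * f = linear_form * ?gen v1 v2 v3 v4"
        unfolding lf by (simp add: generated_def algebra_simps)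
      then have "f = ?gen v1 v2 v3 v4" using linear_form_neq_0[where ?'k = 'k] by simp
      then show ?thesis by (simp only: generated_in_I_ideal)
    qed
    then show ?thesis by blast
  next
    case False
    have "\<exists>f\<in>homogeneous d. h - linear_form * f \<in> ?I" if h: "h \<in> homogeneous (d + 1)" for h :: "'k poly3"
    proof -
      define t where "t = nat (d + 2 - int (A + B + n))"
      have d: "d + 2 = int (A + B + n + t)" using False by (simp add: t_def)
      have "nat (d + 1 + 1) = A + B + n + t" using d by simp
      with coeffs_below_restrict_line[OF h] have "coeffs_below (A + B + n + t) (restrict_line h)" by simp
      from combination_exists[OF char n this \<open>0 < A + B + n\<close>] obtain p1 p2 p3 p4 where
        p: "coeffs_below (A + t) p1" "coeffs_below (B + t) p2" "coeffs_below (\<alpha> + \<beta> + t) p3"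
          "coeffs_below (M + t) p4"
        and h_eq: "restrict_line h = combination (A + n) (A + B + M) \<beta> (A + B) p1 p2 p3 p4" by blast
      let ?u1 = "homogenize (d + 1 - int (B + n)) p1" and ?u2 = "homogenize (d + 1 - int (A + n)) p2"
        and ?u3 = "homogenize (d + 1 - int (A + B + M)) p3"
        and ?u4 = "homogenize (d + 1 - int (\<alpha> + \<beta> + (A + B))) p4"
      have "nat (d + 1 - int (B + n) + 1) = A + t" "nat (d + 1 - int (A + n) + 1) = B + t"
        "nat (d + 1 - int (A + B + M) + 1) = \<alpha> + \<beta> + t"
        "nat (d + 1 - int (\<alpha> + \<beta> + (A + B)) + 1) = M + t"
        using d n by linarith+
      with p have "restrict_line ?u1 = p1" "restrict_line ?u2 = p2" "restrict_line ?u3 = p3"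
        "restrict_line ?u4 = p4"
        by (simp_all add: restrict_line_homogenize)
      then have "restrict_line (h - ?gen ?u1 ?u2 ?u3 ?u4) = 0"
        by (simp add: restrict_line_diff restrict_line_generated h_eq)
      moreover have "h - ?gen ?u1 ?u2 ?u3 ?u4 \<in> homogeneous (d + 1)"
      proof -
        have "monomial3 i j k * homogenize (d + 1 - int (i + j + k)) q \<in> homogeneous (d + 1)"
          for i j k and q :: "'k poly"
          using homogeneous_mult[OF homogeneous_monomial3[of i j k] homogenize_homogeneous[of "d + 1 - int (i + j + k)" q]]
          by simp
        from this[of "B + n" 0 0 p1] this[of 0 "A + n" 0 p2] this[of 0 0 "A + B + M" p3]
          this[of \<alpha> \<beta> "A + B" p4]
        have "?gen ?u1 ?u2 ?u3 ?u4 \<in> homogeneous (d + 1)"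
          unfolding generated_def by (intro homogeneous_add) simp_all
        with h show ?thesis by (rule homogeneous_diff)
      qed
      ultimately obtain f where "f \<in> homogeneous d" "h - ?gen ?u1 ?u2 ?u3 ?u4 = linear_form * f"
        using restrict_line_eq_0D[of _ "d + 1"] by fastforce
      then have "h - linear_form * f = ?gen ?u1 ?u2 ?u3 ?u4" by (simp add: algebra_simps)
      with \<open>f \<in> homogeneous d\<close> show ?thesis using generated_in_I_ideal by metis
    qed
    then show ?thesis by blast
  qed
qed

theorem proposition6p9:
  fixes a b c \<alpha> \<beta> \<gamma> s A B C M :: int
  assumes "0 \<le> \<alpha>" "\<alpha> < a" "0 \<le> \<beta>" "\<beta> < b" "0 \<le> \<gamma>" "\<gamma> < c"
    and "\<not> (\<alpha> = 0 \<and> \<beta> = 0)" "\<not> (\<alpha> = 0 \<and> \<gamma> = 0)" "\<not> (\<beta> = 0 \<and> \<gamma> = 0)"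
    and "(a + b + c + \<alpha> + \<beta> + \<gamma>) mod 3 = 0"
    and "s = (a + b + c + \<alpha> + \<beta> + \<gamma>) div 3 - 2"
    and "A = s + 2 - a" "B = s + 2 - b" "C = s + 2 - c" "M = s + 2 - (\<alpha> + \<beta> + \<gamma>)"
    and "0 \<le> M" "0 \<le> A" "A \<le> \<beta> + \<gamma>" "0 \<le> B" "B \<le> \<alpha> + \<gamma>" "0 \<le> C" "C \<le> \<alpha> + \<beta>"
    and "rat_of_int c = rat_of_int (a + b + \<gamma>) / 2 - rat_of_int \<alpha> - rat_of_int \<beta>"
  shows "C = \<alpha> + \<beta> \<and>
    rat_of_int (det (N_matrix a b c \<alpha> \<beta> \<gamma>)) =
      (-1) ^ nat (M * \<alpha>) * Mac (nat A) (nat B) (nat (C + M)) \<and>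
    A + B + C + M = s + 2 \<and> s + 2 = c + \<alpha> + \<beta> \<and>
    (infinite (UNIV :: 'k::field set) \<longrightarrow>
      CHAR('k) = 0 \<or> int CHAR('k) \<ge> A + B + C + M \<longrightarrow>
      ideal_weak_Lefschetz (I_ideal a b c \<alpha> \<beta> \<gamma> :: 'k poly3 set))"
proof -
  have "2 * rat_of_int c = rat_of_int (a + b + \<gamma>) - 2 * rat_of_int \<alpha> - 2 * rat_of_int \<beta>"
    using assms(23) by (simp add: field_simps)
  then have "rat_of_int (2 * c) = rat_of_int (a + b + \<gamma> - 2 * \<alpha> - 2 * \<beta>)" by simp
  then have c2: "2 * c = a + b + \<gamma> - 2 * \<alpha> - 2 * \<beta>" by (simp only: of_int_eq_iff)
  then have "a + b + c + \<alpha> + \<beta> + \<gamma> = 3 * (c + \<alpha> + \<beta>)" by simp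
  then have s: "s + 2 = c + \<alpha> + \<beta>" using assms(11) by simp
  then have C: "C = \<alpha> + \<beta>" and \<gamma>: "\<gamma> = A + B" and c: "c = A + B + M"
    using assms(12-15) c2 by linarith+
  define A' B' M' \<alpha>' \<beta>' where "A' = nat A" and "B' = nat B" and "M' = nat M" and "\<alpha>' = nat \<alpha>" and "\<beta>' = nat \<beta>"
  note nat_defs = A'_def B'_def M'_def \<alpha>'_def \<beta>'_def
  let ?n = "\<alpha>' + \<beta>' + M'"
  have ints: "A = int A'" "B = int B'" "M = int M'" "\<alpha> = int \<alpha>'" "\<beta> = int \<beta>'"
    using assms(1,3,16,17,19) by (simp_all add: nat_defs)
  have abc: "a = int (B' + ?n)" "b = int (A' + ?n)" "c = int (A' + B' + M')" "\<gamma> = int (A' + B')"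
    using assms(12,13) s c \<gamma> ints unfolding of_nat_add by linarith+
  have "0 < A' + B' + ?n" using assms(7) ints(4,5) by auto
  have N: "N_matrix a b c \<alpha> \<beta> \<gamma> = N_matrix_nat A' B' M' \<alpha>' \<beta>'"
    unfolding ints(4,5)
    by (rule N_matrix_eq_N_matrix_nat[of A' B' M' \<alpha>' \<beta>' "A' + B' + M' + \<alpha>' + \<beta>'"]) (simp_all add: abc)
  have CM: "C + M = int ?n" unfolding C ints(3-5) by simp
  have "nat (M * \<alpha>) = M' * \<alpha>'" unfolding ints(3,4) by (simp flip: of_nat_mult)
  moreover have "nat (C + M) = ?n" unfolding CM by simp
  ultimately have "rat_of_int (det (N_matrix a b c \<alpha> \<beta> \<gamma>)) =
      (-1) ^ nat (M * \<alpha>) * Mac (nat A) (nat B) (nat (C + M))"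
    by (simp add: N det_N_matrix_nat det_binomial_toeplitz_Mac A'_def[symmetric] B'_def[symmetric])
  moreover have "ideal_weak_Lefschetz (I_ideal a b c \<alpha> \<beta> \<gamma> :: 'k poly3 set)"
    if "CHAR('k) = 0 \<or> int CHAR('k) \<ge> A + B + C + M"
  proof -
    have "A + B + C + M = int (A' + B' + ?n)" using CM ints(1,2) by linarith
    with that have "CHAR('k) = 0 \<or> A' + B' + ?n \<le> CHAR('k)" by (simp only: of_nat_le_iff)
    from ideal_weak_Lefschetz_I_ideal[OF this refl \<open>0 < A' + B' + ?n\<close>]
    show ?thesis unfolding abc ints(4,5) .
  qed
  moreover have "A + B + C + M = s + 2" using C s c by linarith
  ultimately show ?thesis using C s by blast
qed

end
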